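(* Let $n\ge 16$ be even and let $W_{4,n}$ be the $4$-regular Kn\"odel graph. Then $W_{4,n}$ is $\gamma$-critical if and only if (i) $n=26$, or (ii) $n\ge 22$ and $n\equiv 2\pmod{10}$, or (iii) $n\ge 38$ and $n\equiv 8\pmod{10}$.
   Context: For an even integer $n\ge 2$ and $1\le\Delta\le\lfloor\log_2 n\rfloor$, the Kn\"odel graph $W_{\Delta,n}$ is the $\Delta$-regular bipartite graph on the $n$ vertices $(i,j)$, $i\in\{1,2\}$, $0\le j\le n/2-1$, in which for every $j$ the vertex $(1,j)$ is adjacent to the vertices $(2,(j+2^k-1)\bmod (n/2))$ for $k=0,1,\dots,\Delta-1$ (and there are no other edges). A set $D$ of vertices of a graph $G$ is dominating if every vertex not in $D$ is adjacent to a vertex of $D$; $\gamma(G)$ is the minimum size of a dominating set. A graph $G$ is $\gamma$-critical if $\gamma(G-u)<\gamma(G)$ for every vertex $u$ of $G$, where $G-u$ is the graph obtained by deleting $u$. *)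

theory Defs
  imports Main
begin

text \<open>Simple graphs given by a (finite) vertex set V and a symmetric adjacency
relation E; only edges between vertices of V are relevant.\<close>

definition dominating :: "'a set \<Rightarrow> ('a \<Rightarrow> 'a \<Rightarrow> bool) \<Rightarrow> 'a set \<Rightarrow> bool" where
  "dominating V E D \<longleftrightarrow> D \<subseteq> V \<and> (\<forall>v\<in>V - D. \<exists>d\<in>D. E d v)"

definition domination_number :: "'a set \<Rightarrow> ('a \<Rightarrow> 'a \<Rightarrow> bool) \<Rightarrow> nat" where
  "domination_number V E = (LEAST k. \<exists>D. dominating V E D \<and> card D = k)"

definition gamma_critical :: "'a set \<Rightarrow> ('a \<Rightarrow> 'a \<Rightarrow> bool) \<Rightarrow> bool" where
  "gamma_critical V E \<longleftrightarrow>
     (\<forall>u\<in>V. domination_number (V - {u}) E < domination_number V E)"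

definition knodel_vertices :: "nat \<Rightarrow> (nat \<times> nat) set" where
  "knodel_vertices n = {1,2} \<times> {0..<n div 2}"

definition knodel_adj :: "nat \<Rightarrow> nat \<Rightarrow> nat \<times> nat \<Rightarrow> nat \<times> nat \<Rightarrow> bool" where
  "knodel_adj \<Delta> n u v \<longleftrightarrow>
     (\<exists>j k. k < \<Delta> \<and> j < n div 2 \<and>
        ((u = (1, j) \<and> v = (2, (j + 2^k - 1) mod (n div 2))) \<or>
         (v = (1, j) \<and> u = (2, (j + 2^k - 1) mod (n div 2)))))"

end

theory Submission
  imports Defs
begin

text \<open>
  Write \<open>m = n / 2\<close> and let \<open>\<alpha>\<close> and \<open>\<beta>\<close> be the numbers of chosen vertices on the two sides. The closed
  neighbourhoods of the chosen vertices hit the first side \<open>\<alpha> + 4\<beta>\<close> times and the second side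
  \<open>\<beta> + 4\<alpha>\<close> times, so a small dominating set leaves only a small bounded excess on each side, and
  for each residue of \<open>m\<close> modulo 5 this pins down \<open>(\<alpha>, \<beta>)\<close> almost completely. In every case that
  counting does not settle, there is an anchor, namely either the single undominated vertex or (if
  \<open>5\<beta> > m\<close>) two chosen vertices at distance at most 4 on one side, and a bounded search around the
  anchor shows that the given excess cannot suffice. The search looks only at a window of vertices of
  bounded size, hence it covers all large \<open>m\<close> at once; for the finitely many \<open>m\<close> shorter than
  the window it is run on the cyclic graph itself. The matching upper bounds are explicit
  patterns of period 5 with a defect.
\<close>

section \<open>Bounded search for coverings with small excess\<close>

datatype vertex = X int | Y int

text \<open>Closed neighbourhoods. As \<open>j mod 0 = j\<close>, the case \<open>m = 0\<close> is the infinite unrolled graph.\<close>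

fun nbrs :: "int \<Rightarrow> vertex \<Rightarrow> vertex list" where
  "nbrs m (X j) = [X (j mod m), Y (j mod m), Y ((j + 1) mod m), Y ((j + 3) mod m), Y ((j + 7) mod m)]"
| "nbrs m (Y j) = [Y (j mod m), X (j mod m), X ((j - 1) mod m), X ((j - 3) mod m), X ((j - 7) mod m)]"

fun normal :: "int \<Rightarrow> vertex \<Rightarrow> bool" where
  "normal m (X j) \<longleftrightarrow> j mod m = j"
| "normal m (Y j) \<longleftrightarrow> j mod m = j"

definition count :: "int \<Rightarrow> vertex set \<Rightarrow> vertex \<Rightarrow> nat" where
  "count m D v = card (set (nbrs m v) \<inter> D)"

text \<open>By truncated subtraction, an uncovered vertex has excess 0.\<close>

definition excess :: "int \<Rightarrow> vertex set \<Rightarrow> vertex set \<Rightarrow> nat" where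
  "excess m D W = (\<Sum>v\<in>W. count m D v - 1)"

lemma normal_nbrs: "d \<in> set (nbrs m v) \<Longrightarrow> normal m d"
  by (cases v) auto

lemma add_mod_eq_iff:
  fixes i j m s :: int
  assumes "i mod m = i" "j mod m = j"
  shows "i = (j + s) mod m \<longleftrightarrow> j = (i - s) mod m"
proof
  assume "i = (j + s) mod m"
  then have "(i - s) mod m = (j + s - s) mod m"
    by (metis mod_diff_left_eq)
  with assms show "j = (i - s) mod m" by simp
next
  assume "j = (i - s) mod m"
  then have "(j + s) mod m = (i - s + s) mod m"
    by (metis mod_add_left_eq)
  with assms show "i = (j + s) mod m" by simp
qed

lemma nbrs_sym:
  assumes "normal m v" "normal m d"
  shows "d \<in> set (nbrs m v) \<longleftrightarrow> v \<in> set (nbrs m d)"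
proof (cases v; cases d)
  fix i j assume "v = X j" "d = Y i"
  with assms show ?thesis
    using add_mod_eq_iff[of i m j] by auto
next
  fix i j assume "v = Y j" "d = X i"
  with assms show ?thesis
    using add_mod_eq_iff[of j m i] by auto
qed (use assms in auto)

text \<open>Entries of a closed neighbourhood that lie on one side have offsets at most 7 apart, so
  \<open>8 \<le> m\<close> keeps them distinct. Modulo 0, congruence is equality.\<close>

lemma mod_eq_small_imp_eq:
  fixes i j m :: int
  assumes "m = 0 \<or> 8 \<le> m" "i mod m = j mod m" "\<bar>i - j\<bar> \<le> 7"
  shows "i = j"
proof -
  have "m dvd i - j" using assms(2) by (simp add: mod_eq_dvd_iff)
  then show ?thesis using assms(1,3) zdvd_imp_le[of m "\<bar>i - j\<bar>"] by fastforce
qed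

lemma distinct_nbrs:
  assumes "m = 0 \<or> 8 \<le> m"
  shows "distinct (nbrs m v)"
proof (cases v)
  case (X j)
  then show ?thesis using assms
    by (auto dest!: mod_eq_small_imp_eq[rotated])
next
  case (Y j)
  then show ?thesis using assms
    by (auto dest!: mod_eq_small_imp_eq[rotated])
qed

lemma count_mono: "S \<subseteq> D \<Longrightarrow> count m S v \<le> count m D v"
  unfolding count_def by (rule card_mono) auto

lemma excess_mono: "S \<subseteq> D \<Longrightarrow> excess m S W \<le> excess m D W"
  unfolding excess_def by (intro sum_mono diff_le_mono count_mono)

text \<open>Inserting \<open>d\<close> raises the count by one at each neighbour of
  \<open>d\<close>. Where the count was 0, the truncated subtraction absorbs this; the excess grows
  only at vertices covered before.\<close>

lemma excess_insert:
  assumes "d \<notin> S" "normal m d" "finite W" "\<forall>v\<in>W. normal m v"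
  shows "excess m (insert d S) W = excess m S W
    + card {v \<in> W. v \<in> set (nbrs m d) \<and> set (nbrs m v) \<inter> S \<noteq> {}}"
proof -
  have "count m (insert d S) v - 1 = (count m S v - 1)
      + of_bool (v \<in> set (nbrs m d) \<and> set (nbrs m v) \<inter> S \<noteq> {})" if "v \<in> W" for v
  proof -
    have sym: "d \<in> set (nbrs m v) \<longleftrightarrow> v \<in> set (nbrs m d)"
      using nbrs_sym assms that by blast
    have pos: "set (nbrs m v) \<inter> S \<noteq> {} \<longleftrightarrow> 0 < count m S v"
      by (simp add: count_def card_gt_0_iff)
    show ?thesis
    proof (cases "d \<in> set (nbrs m v)")
      case True
      then have "set (nbrs m v) \<inter> insert d S = insert d (set (nbrs m v) \<inter> S)" by auto
      then have "count m (insert d S) v = Suc (count m S v)"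
        using assms(1) by (simp add: count_def)
      with True sym pos show ?thesis by simp
    next
      case False
      then have "count m (insert d S) v = count m S v"
        by (simp add: count_def)
      with False sym show ?thesis by simp
    qed
  qed
  then have "excess m (insert d S) W = excess m S W
      + (\<Sum>v\<in>W. of_bool (v \<in> set (nbrs m d) \<and> set (nbrs m v) \<inter> S \<noteq> {}))"
    by (simp add: excess_def sum.distrib)
  also have "(\<Sum>v\<in>W. of_bool (v \<in> set (nbrs m d) \<and> set (nbrs m v) \<inter> S \<noteq> {}))
      = card {v \<in> W. v \<in> set (nbrs m d) \<and> set (nbrs m v) \<inter> S \<noteq> {}}"
    using assms(3) by (simp add: Int_def)
  finally show ?thesis .
qed

fun inX :: "int \<times> int \<times> int \<times> int \<Rightarrow> vertex \<Rightarrow> bool" where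
  "inX (l, h, l', h') (X j) = (if l \<le> j then j \<le> h else False)"
| "inX w (Y j) = False"

fun inY :: "int \<times> int \<times> int \<times> int \<Rightarrow> vertex \<Rightarrow> bool" where
  "inY (l, h, l', h') (Y j) = (if l' \<le> j then j \<le> h' else False)"
| "inY w (X j) = False"

fun mem :: "vertex list \<Rightarrow> vertex \<Rightarrow> bool" where
  "mem [] v = False"
| "mem (x # xs) v = (if x = v then True else mem xs v)"

fun meets :: "vertex list \<Rightarrow> vertex list \<Rightarrow> bool" where
  "meets T [] = False"
| "meets T (x # xs) = (if mem T x then True else meets T xs)"

text \<open>The increase from \<open>excess_insert\<close>, in a form that rewriting can evaluate;
  \<open>p\<close> selects one side of the window.\<close>

fun cost :: "int \<Rightarrow> (vertex \<Rightarrow> bool) \<Rightarrow> vertex list \<Rightarrow> vertex list \<Rightarrow> nat" where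
  "cost m p T [] = 0"
| "cost m p T (v # vs) =
    (if p v then if meets T (nbrs m v) then Suc (cost m p T vs) else cost m p T vs
     else cost m p T vs)"

text \<open>Every vertex of \<open>vs\<close> has to be covered. \<open>T\<close> and \<open>F\<close> list the vertices decided to be inside and
  outside the covering set, and \<open>kx\<close>, \<open>ky\<close> are the remaining excess budgets of the two sides within
  the window \<open>w\<close>. The result \<open>True\<close> means that there is no such set. The conditionals, and the
  separate \<open>branch\<close> in place of a \<open>let\<close>, keep evaluation by rewriting from exploring dead branches.\<close>

function (sequential) search and attempt and branch where
  "search m w kx ky [] T F = False"
| "search m w kx ky (v # vs) T F =
    (if meets T (nbrs m v) then search m w kx ky vs T F
     else attempt m w kx ky vs (nbrs m v) T F)"
| "attempt m w kx ky vs [] T F = True"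
| "attempt m w kx ky vs (d # ds) T F =
    (if mem F d then attempt m w kx ky vs ds T F
     else branch m w kx ky vs d ds T F
       (cost m (inX w) T (nbrs m d)) (cost m (inY w) T (nbrs m d)))"
| "branch m w kx ky vs d ds T F cx cy =
    (if cx \<le> kx
     then if cy \<le> ky
       then if search m w (kx - cx) (ky - cy) vs (d # T) F
         then attempt m w kx ky vs ds T (d # F) else False
       else attempt m w kx ky vs ds T (d # F)
     else attempt m w kx ky vs ds T (d # F))"
  by pat_completeness auto
termination
  \<comment> \<open>The step from \<open>search\<close> to \<open>attempt\<close> shortens
    \<open>vs\<close>. At equal length \<open>search\<close> ranks lowest, and the odd third
    component puts \<open>branch\<close> between \<open>attempt\<close> on \<open>d # ds\<close> and
    on \<open>ds\<close>.\<close>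
  by (relation "inv_image (less_than <*lex*> less_than <*lex*> less_than)
    (\<lambda>x. case x of Inl (_, _, _, _, vs, _, _) \<Rightarrow> (length vs, 0, 0)
      | Inr (Inl (_, _, _, _, vs, ds, _, _)) \<Rightarrow> (length vs, 1, 2 * length ds)
      | Inr (Inr (_, _, _, _, vs, _, ds, _, _, _, _)) \<Rightarrow> (length vs, 1, Suc (2 * length ds)))")
    auto

section \<open>Soundness of the search\<close>

lemma mem_iff: "mem xs v \<longleftrightarrow> v \<in> set xs"
  by (induction xs) auto

lemma meets_iff: "meets T xs \<longleftrightarrow> set xs \<inter> set T \<noteq> {}"
  by (induction xs) (auto simp: mem_iff)

lemma cost_eq_card:
  "distinct vs \<Longrightarrow>
    cost m p T vs = card {v. p v \<and> v \<in> set vs \<and> set (nbrs m v) \<inter> set T \<noteq> {}}"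
proof (induction vs)
  case (Cons v vs)
  let ?A = "\<lambda>vs. {u. p u \<and> u \<in> set vs \<and> set (nbrs m u) \<inter> set T \<noteq> {}}"
  have fin: "finite (?A vs)" by (rule finite_subset[of _ "set vs"]) auto
  show ?case
  proof (cases "p v \<and> meets T (nbrs m v)")
    case True
    then have "?A (v # vs) = insert v (?A vs)" by (auto simp: meets_iff)
    with True Cons fin show ?thesis by simp
  next
    case False
    then have "?A (v # vs) = ?A vs" by (auto simp: meets_iff)
    with False Cons show ?thesis by auto
  qed
qed simp

lemma window_eq_image:
  "{v. inX (l, h, l', h') v} = X ` {l..h}" "{v. inY (l, h, l', h') v} = Y ` {l'..h'}"
  by (auto split: if_splits elim: inX.elims inY.elims)

lemma window_finite: "finite {v. inX w v}" "finite {v. inY w v}"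
  by (cases w; simp only: window_eq_image finite_imageI finite_atLeastAtMost_int)+

text \<open>The budgets are relative to the excess that \<open>T\<close> already has, so choosing a
  vertex only subtracts its own cost.\<close>

definition compatible ::
  "int \<Rightarrow> int \<times> int \<times> int \<times> int \<Rightarrow> nat \<Rightarrow> nat \<Rightarrow> vertex list \<Rightarrow> vertex list \<Rightarrow> vertex set \<Rightarrow> bool" where
  "compatible m w kx ky T F D \<longleftrightarrow> set T \<subseteq> D \<and> set F \<inter> D = {}
    \<and> excess m D {v. inX w v} \<le> excess m (set T) {v. inX w v} + kx
    \<and> excess m D {v. inY w v} \<le> excess m (set T) {v. inY w v} + ky"

text \<open>\<open>nbrs\<close> returns canonical representatives, so on a cycle the window must
  consist of these for the costs to be counted correctly. The condition on \<open>m\<close> makes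
  neighbourhoods duplicate-free.\<close>

definition proper_window :: "int \<Rightarrow> int \<times> int \<times> int \<times> int \<Rightarrow> bool" where
  "proper_window m w \<longleftrightarrow> (m = 0 \<or> 8 \<le> m) \<and> (\<forall>v. inX w v \<or> inY w v \<longrightarrow> normal m v)"

text \<open>Excess is monotone: that of \<open>insert d (set T)\<close> is at most that of
  \<open>D\<close>, hence the increase caused by \<open>d\<close> is within the budget. An
  unaffordable \<open>d\<close> therefore cannot lie in \<open>D\<close>.\<close>

lemma compatible_extend:
  assumes "compatible m w kx ky T F D" "d \<in> D" "d \<notin> set T" "normal m d" "proper_window m w"
  defines "cx \<equiv> cost m (inX w) T (nbrs m d)" and "cy \<equiv> cost m (inY w) T (nbrs m d)"
  shows "cx \<le> kx \<and> cy \<le> ky \<and> compatible m w (kx - cx) (ky - cy) (d # T) F D"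
proof -
  have dist: "distinct (nbrs m d)"
    using assms(5) distinct_nbrs by (simp add: proper_window_def)
  have "excess m (insert d (set T)) {v. p v} = excess m (set T) {v. p v} + cost m p T (nbrs m d)"
    if "finite {v. p v}" "\<forall>v. p v \<longrightarrow> normal m v" for p
    using that assms(3,4) by (simp add: excess_insert cost_eq_card[OF dist])
  then have ex: "excess m (insert d (set T)) {v. inX w v} = excess m (set T) {v. inX w v} + cx"
      "excess m (insert d (set T)) {v. inY w v} = excess m (set T) {v. inY w v} + cy"
    using assms(5) window_finite by (simp_all add: proper_window_def cx_def cy_def)
  have "insert d (set T) \<subseteq> D" using assms(1,2) by (simp add: compatible_def)
  then have "excess m (insert d (set T)) {v. inX w v} \<le> excess m D {v. inX w v}"
      "excess m (insert d (set T)) {v. inY w v} \<le> excess m D {v. inY w v}"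
    by (simp_all add: excess_mono)
  with ex assms(1,2) show ?thesis by (simp add: compatible_def)
qed

lemma compatible_exclude:
  "compatible m w kx ky T F D \<Longrightarrow> d \<notin> D \<Longrightarrow> compatible m w kx ky T (d # F) D"
  by (simp add: compatible_def)

lemma search_sound:
  "\<lbrakk>search m w kx ky vs T F; proper_window m w; compatible m w kx ky T F D;
    \<forall>v\<in>set vs. set (nbrs m v) \<inter> D \<noteq> {}\<rbrakk> \<Longrightarrow> False"
  "\<lbrakk>attempt m w kx ky vs ds T F; proper_window m w; compatible m w kx ky T F D;
    \<forall>v\<in>set vs. set (nbrs m v) \<inter> D \<noteq> {};
    \<forall>d\<in>set ds. normal m d; set ds \<inter> set T = {}; set ds \<inter> D \<noteq> {}\<rbrakk> \<Longrightarrow> False"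
  "\<lbrakk>branch m w kx ky vs d ds T F cx cy; proper_window m w; compatible m w kx ky T F D;
    \<forall>v\<in>set vs. set (nbrs m v) \<inter> D \<noteq> {};
    \<forall>d\<in>set (d # ds). normal m d; set (d # ds) \<inter> set T = {}; set (d # ds) \<inter> D \<noteq> {};
    cx = cost m (inX w) T (nbrs m d); cy = cost m (inY w) T (nbrs m d)\<rbrakk> \<Longrightarrow> False"
proof (induction m w kx ky vs T F and m w kx ky vs ds T F and m w kx ky vs d ds T F cx cy
    rule: search_attempt_branch.induct)
  case (2 m w kx ky v vs T F)
  show ?case
  proof (cases "meets T (nbrs m v)")
    case True
    with 2 show ?thesis by simp
  next
    case False
    with 2 normal_nbrs show ?thesis by (simp add: meets_iff)
  qed
next
  case (4 m w kx ky vs d ds T F)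
  show ?case
  proof (cases "mem F d")
    case True
    then have "d \<notin> D" using 4(5) by (auto simp: compatible_def mem_iff)
    with 4 True show ?thesis by simp
  next
    case False
    with 4 show ?thesis by simp
  qed
next
  case (5 m w kx ky vs d ds T F cx cy)
  show ?case
  proof (cases "d \<in> D")
    case True
    then have "cx \<le> kx \<and> cy \<le> ky \<and> compatible m w (kx - cx) (ky - cy) (d # T) F D"
      using compatible_extend[of m w kx ky T F D d] 5 by simp
    moreover from this have "search m w (kx - cx) (ky - cy) vs (d # T) F"
      using 5(5) by (simp split: if_splits)
    ultimately show ?thesis using 5(1,6,8) by blast
  next
    case False
    then have "compatible m w kx ky T (d # F) D" by (rule compatible_exclude[OF 5(7)])
    moreover have "attempt m w kx ky vs ds T (d # F)" using 5 by (simp split: if_splits)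
    ultimately show ?thesis using 5 False by (simp split: if_splits)
  qed
qed auto

text \<open>The order in which coverage is demanded, outwards from a centre. At \<open>i = 0\<close>
  the centre occurs twice, but the second demand is then already met.\<close>

fun spiral :: "int \<Rightarrow> int \<Rightarrow> int \<Rightarrow> int \<Rightarrow> nat \<Rightarrow> vertex list" where
  "spiral m x y i 0 = []"
| "spiral m x y i (Suc k) = X ((x - i) mod m) # Y ((y - i) mod m) # X ((x + i) mod m) # Y ((y + i) mod m)
    # spiral m x y (i + 1) k"

text \<open>\<open>X 0\<close> is left out because it is the vertex that need not be covered.\<close>

fun in_window :: "int \<times> int \<times> int \<times> int \<Rightarrow> vertex \<Rightarrow> bool" where
  "in_window w (X j) = (if j = 0 then False else inX w (X j))"
| "in_window w (Y j) = inY w (Y j)"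

definition no_hole :: "int \<Rightarrow> int \<times> int \<times> int \<times> int \<Rightarrow> int \<Rightarrow> int \<Rightarrow> nat \<Rightarrow> nat \<Rightarrow> bool" where
  "no_hole m w x y kx ky \<longleftrightarrow>
    search m w kx ky (filter (in_window w) (spiral m x y 0 15)) [] (nbrs m (X 0))"

text \<open>The search is entered through \<open>attempt\<close>: its candidate list expresses that
  one of \<open>Y 1\<close> to \<open>Y 4\<close> is chosen besides \<open>Y 0\<close>.\<close>

definition no_close_pair :: "int \<Rightarrow> int \<times> int \<times> int \<times> int \<Rightarrow> int \<Rightarrow> int \<Rightarrow> nat \<Rightarrow> nat \<Rightarrow> bool" where
  "no_close_pair m w x y kx ky \<longleftrightarrow>
    attempt m w kx ky (spiral m x y 0 15) [Y 1, Y 2, Y 3, Y 4] [Y 0] []"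

text \<open>The windows and centres below were found by experiment; the centres affect only the size of the
  search tree.\<close>

lemma no_hole_0_2: "no_hole 0 (-5, 11, -1, 15) 3 7 0 2"
  by code_simp

lemma no_hole_0_5: "no_hole 0 (-7, 15, -4, 18) 4 7 0 5"
  by code_simp

lemma no_hole_3_2: "no_hole 0 (-12, 14, -10, 16) 1 3 3 2"
  by code_simp

text \<open>From here the suffix is \<open>m\<close> instead of the two budgets. The windows of
  \<open>no_hole_0_2\<close> and \<open>no_hole_3_2\<close> are longer than 12 and 23 respectively,
  so these lengths are searched on the cycle.\<close>

lemma no_hole_12: "no_hole 12 (0, 11, 0, 11) 6 7 0 2"
  by code_simp

lemma no_hole_14: "no_hole 14 (0, 13, 0, 13) 1 2 2 1"
  by code_simp

lemma no_hole_23: "no_hole 23 (0, 22, 0, 22) 0 2 3 2"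
  by code_simp

lemma no_close_pair_3_0: "no_close_pair 0 (-13, 7, -9, 11) (-3) 1 3 0"
  by code_simp

lemma no_close_pair_2_5: "no_close_pair 0 (-17, 11, -14, 14) (-3) 0 2 5"
  by code_simp

lemma no_close_pair_11: "no_close_pair 11 (0, 10, 0, 10) 0 4 3 0"
  by code_simp

lemma no_close_pair_16: "no_close_pair 16 (0, 15, 0, 15) 0 2 3 0"
  by code_simp

lemma no_close_pair_13: "no_close_pair 13 (0, 12, 0, 12) 8 2 2 2"
  by code_simp

lemma no_close_pair_19: "no_close_pair 19 (0, 18, 0, 18) (-3) 0 2 5"
  by code_simp

lemma no_close_pair_24: "no_close_pair 24 (0, 23, 0, 23) (-3) 0 2 5"
  by code_simp

section \<open>Periodic patterns\<close>

text \<open>Subsets of the cycle are represented by their lifts to the infinite graph, so that a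
  single unrolled search applies to every large \<open>m\<close>.\<close>

definition periodic :: "int \<Rightarrow> vertex set \<Rightarrow> bool" where
  "periodic m D \<longleftrightarrow> (\<forall>j. (X (j mod m) \<in> D \<longleftrightarrow> X j \<in> D) \<and> (Y (j mod m) \<in> D \<longleftrightarrow> Y j \<in> D))"

definition covered :: "vertex set \<Rightarrow> vertex \<Rightarrow> bool" where
  "covered D v \<longleftrightarrow> set (nbrs 0 v) \<inter> D \<noteq> {}"

definition hole :: "int \<Rightarrow> vertex set \<Rightarrow> bool" where
  "hole m D \<longleftrightarrow> periodic m D \<and> \<not> covered D (X 0)
    \<and> (\<forall>j. j mod m \<noteq> 0 \<longrightarrow> covered D (X j)) \<and> (\<forall>j. covered D (Y j))"

text \<open>Sums of indicators rather than cardinalities, so that linearity and reindexing of sums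
  apply directly.\<close>

definition num_X :: "int \<Rightarrow> vertex set \<Rightarrow> nat" where
  "num_X m D = (\<Sum>j\<in>{0..<m}. of_bool (X j \<in> D))"

definition num_Y :: "int \<Rightarrow> vertex set \<Rightarrow> nat" where
  "num_Y m D = (\<Sum>j\<in>{0..<m}. of_bool (Y j \<in> D))"

lemma card_set_Int_eq_sum_list:
  "distinct xs \<Longrightarrow> card (set xs \<inter> D) = (\<Sum>d\<leftarrow>xs. of_bool (d \<in> D))"
  by (induction xs) (auto simp: Int_insert_left)

lemma count_0_X:
  "count 0 D (X j) = of_bool (X j \<in> D) + of_bool (Y j \<in> D) + of_bool (Y (j + 1) \<in> D)
    + of_bool (Y (j + 3) \<in> D) + of_bool (Y (j + 7) \<in> D)"
  unfolding count_def by (subst card_set_Int_eq_sum_list) (simp_all add: distinct_nbrs)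

lemma count_0_Y:
  "count 0 D (Y j) = of_bool (Y j \<in> D) + of_bool (X j \<in> D) + of_bool (X (j - 1) \<in> D)
    + of_bool (X (j - 3) \<in> D) + of_bool (X (j - 7) \<in> D)"
  unfolding count_def by (subst card_set_Int_eq_sum_list) (simp_all add: distinct_nbrs)

text \<open>For \<open>8 \<le> m\<close> no two neighbours coincide modulo \<open>m\<close>, so
  nothing is lost by counting in the unrolled graph.\<close>

lemma count_eq_count_0:
  assumes "8 \<le> m" "periodic m D"
  shows "count m D v = count 0 D v"
proof -
  have "count m D v = (\<Sum>d\<leftarrow>nbrs m v. of_bool (d \<in> D))"
    unfolding count_def using assms(1) distinct_nbrs by (simp add: card_set_Int_eq_sum_list)
  then show ?thesis
    using assms(2) by (cases v) (simp_all add: count_0_X count_0_Y periodic_def)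
qed

lemma covered_iff_count: "covered D v \<longleftrightarrow> 0 < count 0 D v"
  by (simp add: covered_def count_def card_gt_0_iff)

lemma covered_X:
  "covered D (X j) \<longleftrightarrow> X j \<in> D \<or> Y j \<in> D \<or> Y (j + 1) \<in> D \<or> Y (j + 3) \<in> D \<or> Y (j + 7) \<in> D"
  by (auto simp: covered_def)

lemma covered_Y:
  "covered D (Y j) \<longleftrightarrow> Y j \<in> D \<or> X j \<in> D \<or> X (j - 1) \<in> D \<or> X (j - 3) \<in> D \<or> X (j - 7) \<in> D"
  by (auto simp: covered_def)

lemma periodic_add:
  assumes "periodic m D"
  shows "X (j mod m + s) \<in> D \<longleftrightarrow> X (j + s) \<in> D" "Y (j mod m + s) \<in> D \<longleftrightarrow> Y (j + s) \<in> D"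
  using assms unfolding periodic_def by (metis mod_add_left_eq)+

lemma periodic_diff:
  assumes "periodic m D"
  shows "X (j mod m - s) \<in> D \<longleftrightarrow> X (j - s) \<in> D" "Y (j mod m - s) \<in> D \<longleftrightarrow> Y (j - s) \<in> D"
  using assms unfolding periodic_def by (metis mod_diff_left_eq)+

lemma count_0_mod:
  assumes "periodic m D"
  shows "count 0 D (X (j mod m)) = count 0 D (X j)" "count 0 D (Y (j mod m)) = count 0 D (Y j)"
  using assms by (simp_all add: count_0_X count_0_Y periodic_add periodic_diff periodic_def)

lemma covered_mod:
  assumes "periodic m D"
  shows "covered D (X (j mod m)) \<longleftrightarrow> covered D (X j)" "covered D (Y (j mod m)) \<longleftrightarrow> covered D (Y j)"
  using assms by (simp_all add: covered_iff_count count_0_mod)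

section \<open>Sums over one period and double counting\<close>

lemma sum_periodic_shift:
  fixes f :: "int \<Rightarrow> nat"
  assumes "0 < m" "\<And>j. f (j mod m) = f j"
  shows "(\<Sum>j\<in>{0..<m}. f (j + s)) = (\<Sum>j\<in>{0..<m}. f j)"
proof -
  have "bij_betw (\<lambda>j. (j + s) mod m) {0..<m} {0..<m}"
    by (rule bij_betw_byWitness[where f' = "\<lambda>j. (j - s) mod m"])
      (use assms(1) in \<open>auto simp: mod_simps\<close>)
  then have "(\<Sum>j\<in>{0..<m}. f ((j + s) mod m)) = (\<Sum>j\<in>{0..<m}. f j)"
    by (rule sum.reindex_bij_betw)
  then show ?thesis by (simp add: assms(2))
qed

lemma sum_periodic_uminus:
  fixes f :: "int \<Rightarrow> nat"
  assumes "0 < m" "\<And>j. f (j mod m) = f j"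
  shows "(\<Sum>j\<in>{0..<m}. f (- j)) = (\<Sum>j\<in>{0..<m}. f j)"
proof -
  have "bij_betw (\<lambda>j. (- j) mod m) {0..<m} {0..<m}"
    by (rule bij_betw_byWitness[where f' = "\<lambda>j. (- j) mod m"])
      (use assms(1) in \<open>auto simp: mod_simps\<close>)
  then have "(\<Sum>j\<in>{0..<m}. f ((- j) mod m)) = (\<Sum>j\<in>{0..<m}. f j)"
    by (rule sum.reindex_bij_betw)
  then show ?thesis by (simp add: assms(2))
qed

text \<open>An interval of at most \<open>m\<close> integers meets every residue at most once, so
  its sum is part of the sum over a period.\<close>

lemma sum_periodic_interval_le:
  fixes f :: "int \<Rightarrow> nat"
  assumes "0 < m" "\<And>j. f (j mod m) = f j" "h < l + m"
  shows "(\<Sum>j\<in>{l..h}. f j) \<le> (\<Sum>j\<in>{0..<m}. f j)"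
proof -
  have "inj_on (\<lambda>j. j mod m) {l..h}"
  proof (rule inj_onI)
    fix i j assume ij: "i \<in> {l..h}" "j \<in> {l..h}" "i mod m = j mod m"
    then have "m dvd i - j" by (simp add: mod_eq_dvd_iff)
    moreover have "\<bar>i - j\<bar> < m" using ij assms(3) by auto
    ultimately show "i = j" using zdvd_imp_le[of m "\<bar>i - j\<bar>"] by force
  qed
  then have "(\<Sum>j\<in>{l..h}. f j) = (\<Sum>j\<in>(\<lambda>j. j mod m) ` {l..h}. f j)"
    by (simp add: sum.reindex assms(2))
  also have "\<dots> \<le> (\<Sum>j\<in>{0..<m}. f j)"
    by (rule sum_mono2) (use assms(1) in auto)
  finally show ?thesis .
qed

text \<open>Double counting: a chosen vertex covers itself on its own side and four vertices on the
  other side.\<close>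

lemma sum_count:
  assumes "0 < m" "periodic m D"
  shows "(\<Sum>j\<in>{0..<m}. count 0 D (X j)) = num_X m D + 4 * num_Y m D"
    "(\<Sum>j\<in>{0..<m}. count 0 D (Y j)) = num_Y m D + 4 * num_X m D"
proof -
  have shift: "(\<Sum>j\<in>{0..<m}. of_bool (X (j + s) \<in> D)) = num_X m D"
      "(\<Sum>j\<in>{0..<m}. of_bool (Y (j + s) \<in> D)) = num_Y m D" for s
    unfolding num_X_def num_Y_def
    using assms sum_periodic_shift[of m "\<lambda>j. of_bool (X j \<in> D)" s]
      sum_periodic_shift[of m "\<lambda>j. of_bool (Y j \<in> D)" s]
    by (simp_all add: periodic_def)
  have "(\<Sum>j\<in>{0..<m}. of_bool (X (j - s) \<in> D)) = num_X m D" for s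
    using shift(1)[of "- s"] by simp
  with shift show "(\<Sum>j\<in>{0..<m}. count 0 D (X j)) = num_X m D + 4 * num_Y m D"
    "(\<Sum>j\<in>{0..<m}. count 0 D (Y j)) = num_Y m D + 4 * num_X m D"
    unfolding count_0_X count_0_Y sum.distrib
    by (simp_all add: num_X_def num_Y_def del: sum_of_bool_eq)
qed

lemma excess_add_covered:
  fixes f :: "int \<Rightarrow> vertex"
  shows "(\<Sum>j\<in>{0..<m}. count 0 D (f j) - 1) + card {j \<in> {0..<m}. covered D (f j)}
    = (\<Sum>j\<in>{0..<m}. count 0 D (f j))"
proof -
  have "count 0 D (f j) = (count 0 D (f j) - 1) + of_bool (covered D (f j))" for j
    by (simp add: covered_iff_count)
  then have "(\<Sum>j\<in>{0..<m}. count 0 D (f j))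
      = (\<Sum>j\<in>{0..<m}. (count 0 D (f j) - 1) + of_bool (covered D (f j)))"
    by (intro sum.cong) auto
  then show ?thesis by (simp add: sum.distrib Int_def)
qed

section \<open>Transfer of the search results to periodic patterns\<close>

lemma window_excess_le:
  assumes "8 \<le> m" "periodic m D" "m' = 0 \<or> m' = m" "h < l + m" "h' < l' + m"
  shows "excess m' D {v. inX (l, h, l', h') v} \<le> (\<Sum>j\<in>{0..<m}. count 0 D (X j) - 1)"
    "excess m' D {v. inY (l, h, l', h') v} \<le> (\<Sum>j\<in>{0..<m}. count 0 D (Y j) - 1)"
proof -
  have "count m' D v = count 0 D v" for v using assms count_eq_count_0 by blast
  then have "excess m' D {v. inX (l, h, l', h') v} = (\<Sum>j\<in>{l..h}. count 0 D (X j) - 1)"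
      "excess m' D {v. inY (l, h, l', h') v} = (\<Sum>j\<in>{l'..h'}. count 0 D (Y j) - 1)"
    by (simp_all add: excess_def window_eq_image sum.reindex inj_on_def)
  then show "excess m' D {v. inX (l, h, l', h') v} \<le> (\<Sum>j\<in>{0..<m}. count 0 D (X j) - 1)"
    "excess m' D {v. inY (l, h, l', h') v} \<le> (\<Sum>j\<in>{0..<m}. count 0 D (Y j) - 1)"
    using assms sum_periodic_interval_le[of m "\<lambda>j. count 0 D (X j) - 1"]
      sum_periodic_interval_le[of m "\<lambda>j. count 0 D (Y j) - 1"]
    by (simp_all add: count_0_mod)
qed

text \<open>The window spans at most one period on each side, and its \<open>X\<close> part contains
  no multiple of \<open>m\<close> other than 0, so it sees at most one copy of the hole. On the
  cycle (\<open>m' = m\<close>) it must also lie in the canonical range.\<close>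

definition fits :: "int \<Rightarrow> int \<Rightarrow> int \<times> int \<times> int \<times> int \<Rightarrow> bool" where
  "fits m m' w \<longleftrightarrow> (case w of (l, h, l', h') \<Rightarrow>
    8 \<le> m \<and> - m < l \<and> h < m \<and> h < l + m \<and> h' < l' + m
    \<and> (m' = 0 \<or> m' = m \<and> 0 \<le> l \<and> 0 \<le> l' \<and> h' < m))"

lemma fits_proper_window: "fits m m' w \<Longrightarrow> proper_window m' w"
proof -
  assume fit: "fits m m' w"
  obtain l h l' h' where w: "w = (l, h, l', h')" by (cases w)
  have "normal m' v" if "v \<in> {v. inX w v} \<union> {v. inY w v}" for v
    using that fit by (auto simp: fits_def w window_eq_image simp del: mem_Collect_eq)
  then show "proper_window m' w"
    using fit by (auto simp: proper_window_def w fits_def)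
qed

lemma compatible_initial:
  assumes "fits m m' w" "periodic m D" "set T \<subseteq> D" "set F \<inter> D = {}"
    "(\<Sum>j\<in>{0..<m}. count 0 D (X j) - 1) \<le> kx" "(\<Sum>j\<in>{0..<m}. count 0 D (Y j) - 1) \<le> ky"
  shows "compatible m' w kx ky T F D"
proof -
  obtain l h l' h' where w: "w = (l, h, l', h')" by (cases w)
  have "excess m' D {v. inX w v} \<le> kx" "excess m' D {v. inY w v} \<le> ky"
    using window_excess_le[of m D m' h l h' l'] assms by (auto simp: w fits_def)
  then show ?thesis using assms(3,4) by (simp add: compatible_def)
qed

lemma fits_covered:
  assumes "fits m m' w" "periodic m D"
  shows "set (nbrs m' v) \<inter> D \<noteq> {} \<longleftrightarrow> covered D v"
proof -
  have "count m' D v = count 0 D v"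
    using assms count_eq_count_0 by (auto simp: fits_def)
  moreover have "set (nbrs m' v) \<inter> D \<noteq> {} \<longleftrightarrow> 0 < count m' D v"
    by (simp add: count_def card_gt_0_iff)
  ultimately show ?thesis by (simp only: covered_iff_count)
qed

lemma no_hole_sound:
  assumes "no_hole m' w x y kx ky" "fits m m' w" "hole m D"
  shows "kx < (\<Sum>j\<in>{0..<m}. count 0 D (X j) - 1) \<or> ky < (\<Sum>j\<in>{0..<m}. count 0 D (Y j) - 1)"
proof (rule ccontr)
  assume "\<not> ?thesis"
  have D: "periodic m D" using assms(3) by (simp add: hole_def)
  note cov = fits_covered[OF assms(2) D]
  have "set (nbrs m' (X 0)) \<inter> D = {}"
    using cov assms(3) unfolding hole_def by blast
  with \<open>\<not> ?thesis\<close> D have "compatible m' w kx ky [] (nbrs m' (X 0)) D"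
    using assms(2) by (intro compatible_initial) auto
  moreover have "\<forall>v\<in>set (filter (in_window w) (spiral m' x y 0 15)). set (nbrs m' v) \<inter> D \<noteq> {}"
  proof
    fix v assume "v \<in> set (filter (in_window w) (spiral m' x y 0 15))"
    then have v: "in_window w v" by simp
    obtain l h l' h' where w: "w = (l, h, l', h')" by (cases w)
    show "set (nbrs m' v) \<inter> D \<noteq> {}"
    proof (cases v)
      case (X j)
      \<comment> \<open>Only multiples of \<open>m\<close> are exempt from being covered, and 0 is
        the only one in the \<open>X\<close> part of the window.\<close>
      with v assms(2) have "j \<noteq> 0" "\<bar>j\<bar> < m" by (auto simp: w fits_def split: if_splits)
      then have "j mod m \<noteq> 0" using zdvd_imp_le[of m "\<bar>j\<bar>"] by (auto simp: mod_eq_0_iff_dvd)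
      with X assms(3) show ?thesis unfolding cov hole_def by blast
    next
      case (Y j)
      with assms(3) show ?thesis unfolding cov hole_def by blast
    qed
  qed
  ultimately show False
    using search_sound(1) fits_proper_window assms(1,2) unfolding no_hole_def by blast
qed

lemma no_close_pair_sound:
  assumes "no_close_pair m' w x y kx ky" "fits m m' w" "periodic m D" "\<And>v. covered D v"
    and "Y 0 \<in> D" "Y 1 \<in> D \<or> Y 2 \<in> D \<or> Y 3 \<in> D \<or> Y 4 \<in> D"
  shows "kx < (\<Sum>j\<in>{0..<m}. count 0 D (X j) - 1) \<or> ky < (\<Sum>j\<in>{0..<m}. count 0 D (Y j) - 1)"
proof (rule ccontr)
  assume "\<not> ?thesis"
  then have "compatible m' w kx ky [Y 0] [] D"
    using assms(2,3,5) by (intro compatible_initial) auto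
  moreover have "\<forall>v\<in>set (spiral m' x y 0 15). set (nbrs m' v) \<inter> D \<noteq> {}"
    using fits_covered[OF assms(2,3)] assms(4) by blast
  moreover have "\<forall>d\<in>set [Y 1, Y 2, Y 3, Y 4]. normal m' d"
    using assms(2) by (auto simp: fits_def)
  moreover have "set [Y 1, Y 2, Y 3, Y 4] \<inter> set [Y 0] = {}"
      "set [Y 1, Y 2, Y 3, Y 4] \<inter> D \<noteq> {}"
    using assms(6) by auto
  ultimately show False
    using search_sound(2) fits_proper_window assms(1,2) unfolding no_close_pair_def by blast
qed

section \<open>Symmetries and the resulting counting bounds\<close>

fun shift :: "int \<Rightarrow> vertex \<Rightarrow> vertex" where
  "shift p (X j) = X (j + p)"
| "shift p (Y j) = Y (j + p)"

text \<open>The reflection is an automorphism exchanging the sides, because seen from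
  \<open>Y\<close> the offsets 0, 1, 3, 7 have the opposite sign.\<close>

fun flip :: "vertex \<Rightarrow> vertex" where
  "flip (X j) = Y (- j)"
| "flip (Y j) = X (- j)"

lemma covered_shift: "covered (shift p -` D) v \<longleftrightarrow> covered D (shift p v)"
  by (cases v) (simp_all add: covered_X covered_Y algebra_simps)

lemma covered_flip: "covered (flip -` D) v \<longleftrightarrow> covered D (flip v)"
  by (cases v) (simp_all add: covered_X covered_Y algebra_simps)

lemma periodic_shift: "periodic m D \<Longrightarrow> periodic m (shift p -` D)"
  by (simp add: periodic_def[of _ "shift p -` D"] periodic_add)

lemma periodic_uminus:
  assumes "periodic m D"
  shows "X (- (j mod m)) \<in> D \<longleftrightarrow> X (- j) \<in> D" "Y (- (j mod m)) \<in> D \<longleftrightarrow> Y (- j) \<in> D"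
  using assms unfolding periodic_def by (metis mod_minus_eq)+

lemma periodic_flip: "periodic m D \<Longrightarrow> periodic m (flip -` D)"
  by (simp add: periodic_def[of _ "flip -` D"] periodic_uminus)

lemma num_shift:
  assumes "0 < m" "periodic m D"
  shows "num_X m (shift p -` D) = num_X m D" "num_Y m (shift p -` D) = num_Y m D"
  using assms sum_periodic_shift[of m "\<lambda>j. of_bool (X j \<in> D)" p]
    sum_periodic_shift[of m "\<lambda>j. of_bool (Y j \<in> D)" p]
  by (simp_all add: num_X_def num_Y_def periodic_def del: sum_of_bool_eq)

lemma num_flip:
  assumes "0 < m" "periodic m D"
  shows "num_X m (flip -` D) = num_Y m D" "num_Y m (flip -` D) = num_X m D"
  using assms sum_periodic_uminus[of m "\<lambda>j. of_bool (X j \<in> D)"]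
    sum_periodic_uminus[of m "\<lambda>j. of_bool (Y j \<in> D)"]
  by (simp_all add: num_X_def num_Y_def periodic_def del: sum_of_bool_eq)

text \<open>Otherwise any five consecutive positions contain at most one chosen \<open>Y\<close>.
  Summing over all \<open>m\<close> such blocks counts every chosen \<open>Y\<close> five times, so
  five times their number would be at most \<open>m\<close>.\<close>

lemma close_pair_exists:
  assumes "0 < m" "periodic m D" "m < 5 * int (num_Y m D)"
  obtains p where "Y p \<in> D"
    "Y (p + 1) \<in> D \<or> Y (p + 2) \<in> D \<or> Y (p + 3) \<in> D \<or> Y (p + 4) \<in> D"
proof (rule ccontr)
  assume "\<not> thesis"
  then have far: "Y (p + s) \<notin> D" if "Y p \<in> D" "s \<in> {1, 2, 3, 4}" for p s
    using that \<open>\<And>p. \<lbrakk>Y p \<in> D; Y (p + 1) \<in> D \<or> Y (p + 2) \<in> D \<or> Y (p + 3) \<in> D \<or> Y (p + 4) \<in> D\<rbrakk> \<Longrightarrow> thesis\<close>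
    by auto
  let ?f = "\<lambda>j s. of_bool (Y (j + s) \<in> D) :: nat"
  have le: "?f j 0 + ?f j 1 + ?f j 2 + ?f j 3 + ?f j 4 \<le> 1" for j
    using far[of j 1] far[of j 2] far[of j 3] far[of j 4]
      far[of "j + 1" 1] far[of "j + 1" 2] far[of "j + 1" 3]
      far[of "j + 2" 1] far[of "j + 2" 2] far[of "j + 3" 1]
    by (auto simp: add.assoc)
  have "(\<Sum>j\<in>{0..<m}. ?f j s) = num_Y m D" for s
    using assms(1,2) sum_periodic_shift[of m "\<lambda>j. of_bool (Y j \<in> D)" s]
    by (simp add: num_Y_def periodic_def del: sum_of_bool_eq)
  then have "5 * num_Y m D = (\<Sum>j\<in>{0..<m}. ?f j 0 + ?f j 1 + ?f j 2 + ?f j 3 + ?f j 4)"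
    by (simp only: sum.distrib)
  also have "\<dots> \<le> (\<Sum>j\<in>{0..<m}. 1)"
    using le by (rule sum_mono)
  finally have "5 * num_Y m D \<le> nat m" by simp
  with assms(1,3) show False by linarith
qed

lemma excess_covered:
  assumes "0 < m" "periodic m D" "\<And>v. covered D v"
  shows "int (\<Sum>j\<in>{0..<m}. count 0 D (X j) - 1) = int (num_X m D + 4 * num_Y m D) - m"
    "int (\<Sum>j\<in>{0..<m}. count 0 D (Y j) - 1) = int (num_Y m D + 4 * num_X m D) - m"
proof -
  have "int (card {j \<in> {0..<m}. covered D (f j)}) = m" for f
    using assms(1,3) by (simp only: Collect_mem_eq simp_thms) simp
  from this[of X] this[of Y]
  show "int (\<Sum>j\<in>{0..<m}. count 0 D (X j) - 1) = int (num_X m D + 4 * num_Y m D) - m"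
    "int (\<Sum>j\<in>{0..<m}. count 0 D (Y j) - 1) = int (num_Y m D + 4 * num_X m D) - m"
    using excess_add_covered[of D X m] excess_add_covered[of D Y m] sum_count[OF assms(1,2)]
    by linarith+
qed

lemma excess_hole:
  assumes "0 < m" "hole m D"
  shows "int (\<Sum>j\<in>{0..<m}. count 0 D (X j) - 1) = int (num_X m D + 4 * num_Y m D) - (m - 1)"
    "int (\<Sum>j\<in>{0..<m}. count 0 D (Y j) - 1) = int (num_Y m D + 4 * num_X m D) - m"
proof -
  have D: "periodic m D" "\<not> covered D (X 0)" "\<And>j. j mod m \<noteq> 0 \<Longrightarrow> covered D (X j)"
      "\<And>j. covered D (Y j)"
    using assms(2) by (simp_all add: hole_def)
  have "{j \<in> {0..<m}. covered D (X j)} = {1..<m}"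
    using assms(1) D(2,3) by (auto simp: order.order_iff_strict)
  then have "int (card {j \<in> {0..<m}. covered D (X j)}) = m - 1" using assms(1) by simp
  moreover have "int (card {j \<in> {0..<m}. covered D (Y j)}) = m"
    using assms(1) D(4) by (simp only: Collect_mem_eq simp_thms) simp
  ultimately show "int (\<Sum>j\<in>{0..<m}. count 0 D (X j) - 1) = int (num_X m D + 4 * num_Y m D) - (m - 1)"
    "int (\<Sum>j\<in>{0..<m}. count 0 D (Y j) - 1) = int (num_Y m D + 4 * num_X m D) - m"
    using excess_add_covered[of D X m] excess_add_covered[of D Y m] sum_count[OF assms(1) D(1)]
    by linarith+
qed

lemma no_close_pair_bound:
  assumes "no_close_pair m' w x y kx ky" "fits m m' w" "periodic m D" "\<And>v. covered D v"
    and "m < 5 * int (num_Y m D)"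
  shows "m + int kx < int (num_X m D + 4 * num_Y m D) \<or> m + int ky < int (num_Y m D + 4 * num_X m D)"
proof -
  have m: "0 < m" using assms(2) by (auto simp: fits_def)
  obtain p where p: "Y p \<in> D"
      "Y (p + 1) \<in> D \<or> Y (p + 2) \<in> D \<or> Y (p + 3) \<in> D \<or> Y (p + 4) \<in> D"
    using close_pair_exists[OF m assms(3,5)] .
  let ?D = "shift p -` D"
  have D: "periodic m ?D" "\<And>v. covered ?D v"
    using assms(3,4) by (simp_all add: periodic_shift covered_shift)
  have "kx < (\<Sum>j\<in>{0..<m}. count 0 ?D (X j) - 1) \<or> ky < (\<Sum>j\<in>{0..<m}. count 0 ?D (Y j) - 1)"
    by (rule no_close_pair_sound[OF assms(1,2) D]) (use p in \<open>simp_all add: add.commute\<close>)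
  then show ?thesis
    using excess_covered[OF m D] num_shift[OF m assms(3), of p] by linarith
qed

lemma no_hole_bound:
  assumes "no_hole m' w x y kx ky" "fits m m' w" "hole m D"
  shows "m - 1 + int kx < int (num_X m D + 4 * num_Y m D) \<or> m + int ky < int (num_Y m D + 4 * num_X m D)"
proof -
  have m: "0 < m" using assms(2) by (auto simp: fits_def)
  show ?thesis
    using no_hole_sound[OF assms] excess_hole[OF m assms(3)] by linarith
qed

section \<open>Lower bounds\<close>

lemma no_close_pair_bound_flip:
  assumes "no_close_pair m' w x y kx ky" "fits m m' w" "periodic m D" "\<And>v. covered D v"
    and "m < 5 * int (num_X m D)"
  shows "m + int kx < int (num_Y m D + 4 * num_X m D) \<or> m + int ky < int (num_X m D + 4 * num_Y m D)"
proof -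
  have "0 < m" using assms(2) by (auto simp: fits_def)
  then show ?thesis
    using no_close_pair_bound[OF assms(1,2), of "flip -` D"] assms(3-5)
    by (simp add: periodic_flip covered_flip num_flip)
qed

lemma covered_bounds:
  assumes "0 < m" "periodic m D" "\<And>v. covered D v"
  shows "m \<le> int (num_X m D + 4 * num_Y m D)" "m \<le> int (num_Y m D + 4 * num_X m D)"
  using excess_covered[OF assms] by linarith+

text \<open>The unrolled window has 21 columns; among the lengths considered only 11 and 16 are
  shorter.\<close>

lemma no_close_pair_1_mod_5:
  assumes "m mod 5 = 1" "11 \<le> (m::int)"
  obtains m' w x y where "fits m m' w" "no_close_pair m' w x y 3 0"
proof -
  have "m = 11 \<or> m = 16 \<or> 21 \<le> m" using assms by presburger
  then show ?thesis
    using that[OF _ no_close_pair_11] that[OF _ no_close_pair_16] that[OF _ no_close_pair_3_0]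
    by (auto simp: fits_def)
qed

text \<open>The unrolled window has 29 columns; among the lengths considered only 19 and 24 are
  shorter.\<close>

lemma no_close_pair_4_mod_5:
  assumes "m mod 5 = 4" "19 \<le> (m::int)"
  obtains m' w x y where "fits m m' w" "no_close_pair m' w x y 2 5"
proof -
  have "m = 19 \<or> m = 24 \<or> 29 \<le> m" using assms by presburger
  then show ?thesis
    using that[OF _ no_close_pair_19] that[OF _ no_close_pair_24] that[OF _ no_close_pair_2_5] by (auto simp: fits_def)
qed

text \<open>With at most 2q + 1 vertices, counting forces q on one side and q + 1 on the other. The
  larger side has a close pair, its own excess is 0, and the opposite excess is 3.\<close>

lemma covered_lower_bound_1:
  assumes "m = 5 * int q + 1" "2 \<le> q" "periodic m D" "\<And>v. covered D v"
  shows "2 * q + 2 \<le> num_X m D + num_Y m D"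
proof (rule ccontr)
  assume small: "\<not> 2 * q + 2 \<le> num_X m D + num_Y m D"
  have m: "0 < m" "m mod 5 = 1" "11 \<le> m" using assms(1,2) by presburger+
  obtain m' w x y where run: "fits m m' w" "no_close_pair m' w x y 3 0"
    using no_close_pair_1_mod_5[OF m(2,3)] .
  note bounds = covered_bounds[OF m(1) assms(3,4)]
  have "q \<le> num_X m D" "q \<le> num_Y m D" using small bounds assms(1) by linarith+
  then have "num_X m D = q \<and> num_Y m D = q + 1 \<or> num_X m D = q + 1 \<and> num_Y m D = q"
    using small bounds assms(1) by arith
  then show False
    using no_close_pair_bound[OF run(2,1) assms(3,4)]
      no_close_pair_bound_flip[OF run(2,1) assms(3,4)] assms(1) by auto
qed

text \<open>Six vertices must split as 3 and 3, with excess 2 on each side; a close pair exists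
  because 15 > 13.\<close>

lemma covered_lower_bound_13:
  assumes "periodic 13 D" "\<And>v. covered D v"
  shows "7 \<le> num_X 13 D + num_Y 13 D"
proof (rule ccontr)
  assume small: "\<not> 7 \<le> num_X 13 D + num_Y 13 D"
  then have "num_X 13 D = 3" "num_Y 13 D = 3"
    using covered_bounds[OF _ assms] by auto
  moreover have "fits 13 13 (0, 12, 0, 12)" by (simp add: fits_def)
  ultimately show False
    using no_close_pair_bound[OF no_close_pair_13 _ assms] by auto
qed

text \<open>With at most 2q + 3 vertices, one side has exactly q + 1, already more than a fifth of
  \<open>m\<close>, so the anchor is taken there. The other side has q + 1 or q + 2; the larger
  value gives the budgets 2 and 5.\<close>

lemma covered_lower_bound_4:
  assumes "m = 5 * int q + 4" "3 \<le> q" "periodic m D" "\<And>v. covered D v"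
  shows "2 * q + 4 \<le> num_X m D + num_Y m D"
proof (rule ccontr)
  assume small: "\<not> 2 * q + 4 \<le> num_X m D + num_Y m D"
  have m: "0 < m" "m mod 5 = 4" "19 \<le> m" using assms(1,2) by presburger+
  obtain m' w x y where run: "fits m m' w" "no_close_pair m' w x y 2 5"
    using no_close_pair_4_mod_5[OF m(2,3)] .
  have "q + 1 \<le> num_X m D" "q + 1 \<le> num_Y m D"
    using small covered_bounds[OF m(1) assms(3,4)] assms(1) by linarith+
  then have "num_X m D \<le> q + 2 \<and> num_Y m D = q + 1 \<or> num_X m D = q + 1 \<and> num_Y m D \<le> q + 2"
    using small by arith
  then show False
    using no_close_pair_bound[OF run(2,1) assms(3,4)]
      no_close_pair_bound_flip[OF run(2,1) assms(3,4)] assms(1) by auto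
qed

lemma hole_bounds:
  assumes "0 < m" "hole m D"
  shows "m - 1 \<le> int (num_X m D + 4 * num_Y m D)" "m \<le> int (num_Y m D + 4 * num_X m D)"
  using excess_hole[OF assms] by linarith+

text \<open>With at most 2q + 1 vertices, counting leaves only \<alpha> = q + 1 and \<beta> = q,
  with excess 0 on the side of the hole and 2 on the other.\<close>

lemma hole_lower_bound_2:
  assumes "m = 5 * int q + 2" "2 \<le> q" "hole m D"
  shows "2 * q + 2 \<le> num_X m D + num_Y m D"
proof (rule ccontr)
  assume small: "\<not> 2 * q + 2 \<le> num_X m D + num_Y m D"
  have "m = 12 \<or> 17 \<le> m" using assms(1,2) by presburger
  then have "fits m 12 (0, 11, 0, 11) \<or> fits m 0 (-5, 11, -1, 15)"
    by (auto simp: fits_def)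
  then obtain m' w x y where run: "fits m m' w" "no_hole m' w x y 0 2"
    using no_hole_12 no_hole_0_2 by blast
  have "q + 1 \<le> num_X m D" "q \<le> num_Y m D"
    using small hole_bounds[OF _ assms(3)] assms(1) by linarith+
  then have "num_X m D = q + 1" "num_Y m D = q" using small by linarith+
  then show False
    using no_hole_bound[OF run(2,1) assms(3)] assms(1) by auto
qed

lemma hole_lower_bound_14:
  assumes "hole 14 D"
  shows "7 \<le> num_X 14 D + num_Y 14 D"
proof (rule ccontr)
  assume small: "\<not> 7 \<le> num_X 14 D + num_Y 14 D"
  then have "num_X 14 D = 3" "num_Y 14 D = 3"
    using hole_bounds[OF _ assms] by auto
  moreover have "fits 14 14 (0, 13, 0, 13)" by (simp add: fits_def)
  ultimately show False
    using no_hole_bound[OF no_hole_14 _ assms] by auto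
qed

text \<open>With at most 2q + 2 vertices, counting leaves two splits: \<alpha> = q + 2, \<beta> = q
  with excesses 0 and 5, and \<alpha> = \<beta> = q + 1 with excesses 3 and 2. Each needs its own
  search.\<close>

lemma hole_lower_bound_3:
  assumes "m = 5 * int q + 3" "4 \<le> q" "hole m D"
  shows "2 * q + 3 \<le> num_X m D + num_Y m D"
proof (rule ccontr)
  assume small: "\<not> 2 * q + 3 \<le> num_X m D + num_Y m D"
  have "m = 23 \<or> 28 \<le> m" using assms(1,2) by presburger
  then have "fits m 23 (0, 22, 0, 22) \<or> fits m 0 (-12, 14, -10, 16)"
    by (auto simp: fits_def)
  then obtain m' w x y where run: "fits m m' w" "no_hole m' w x y 3 2"
    using no_hole_3_2 no_hole_23 by blast
  have fit: "fits m 0 (-7, 15, -4, 18)" using assms(1,2) by (simp add: fits_def)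
  have bounds: "m - 1 \<le> int (num_X m D + 4 * num_Y m D)" "m \<le> int (num_Y m D + 4 * num_X m D)"
    using hole_bounds[OF _ assms(3)] assms(1) by simp_all
  then have "q + 1 \<le> num_X m D" "q \<le> num_Y m D"
    using small assms(1) by linarith+
  then have "num_X m D = q + 2 \<and> num_Y m D = q \<or> num_X m D = q + 1 \<and> num_Y m D = q + 1"
    using small bounds assms(1) by arith
  then show False
    using no_hole_bound[OF run(2,1) assms(3)] no_hole_bound[OF no_hole_0_5 fit assms(3)] assms(1) by auto
qed

section \<open>Dominating sets as patterns\<close>

definition vertices_of :: "nat \<Rightarrow> vertex set \<Rightarrow> (nat \<times> nat) set" where
  "vertices_of N P = {1} \<times> {j. j < N \<and> X (int j) \<in> P} \<union> {2} \<times> {j. j < N \<and> Y (int j) \<in> P}"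

definition pattern_of :: "nat \<Rightarrow> (nat \<times> nat) set \<Rightarrow> vertex set" where
  "pattern_of N D = X ` {j. (1, nat (j mod int N)) \<in> D} \<union> Y ` {j. (2, nat (j mod int N)) \<in> D}"

lemma periodic_pattern_of: "periodic (int N) (pattern_of N D)"
  by (auto simp: periodic_def pattern_of_def)

lemma vertices_of_pattern_of: "D \<subseteq> {1, 2} \<times> {0..<N} \<Longrightarrow> vertices_of N (pattern_of N D) = D"
  by (auto simp: vertices_of_def pattern_of_def image_iff)

lemma card_vertices_of:
  "card (vertices_of N P) = num_X (int N) P + num_Y (int N) P"
proof -
  have count: "card {j. j < N \<and> Q (int j)} = (\<Sum>j\<in>{0..<int N}. of_bool (Q j))" for Q
  proof -
    have "int ` {j. j < N \<and> Q (int j)} = {0..<int N} \<inter> {j. Q j}"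
      by (auto elim!: nonneg_int_cases)
    then have "card ({0..<int N} \<inter> {j. Q j}) = card {j. j < N \<and> Q (int j)}"
      using card_image[of int "{j. j < N \<and> Q (int j)}"] by simp
    then show ?thesis by simp
  qed
  have "card (vertices_of N P) = card {j. j < N \<and> X (int j) \<in> P} + card {j. j < N \<and> Y (int j) \<in> P}"
    unfolding vertices_of_def by (subst card_Un_disjoint) (auto simp: card_cartesian_product)
  then show ?thesis
    using count[of "\<lambda>j. X j \<in> P"] count[of "\<lambda>j. Y j \<in> P"] by (simp only: num_X_def num_Y_def)
qed

lemma knodel_adj_4_iff:
  "knodel_adj 4 n u v \<longleftrightarrow> (\<exists>j s. s \<in> {0, 1, 3, 7} \<and> j < n div 2 \<and>
    (u = (1, j) \<and> v = (2, (j + s) mod (n div 2)) \<or> v = (1, j) \<and> u = (2, (j + s) mod (n div 2))))"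
proof -
  have "(\<exists>k<4. P (j + 2 ^ k - 1)) \<longleftrightarrow> (\<exists>s\<in>{0, 1, 3, 7}. P (j + s))" for P and j :: nat
    by (simp add: numeral_eq_Suc less_Suc_eq ex_disj_distrib conj_disj_distribR)
  note powers = this
  let ?R = "\<lambda>j i. u = (1, j) \<and> v = (2, i mod (n div 2)) \<or> v = (1, j) \<and> u = (2, i mod (n div 2))"
  have "knodel_adj 4 n u v \<longleftrightarrow> (\<exists>j<n div 2. \<exists>k<4. ?R j (j + 2 ^ k - 1))"
    unfolding knodel_adj_def by (rule iffI; elim exE conjE; intro exI conjI)
  also have "\<dots> \<longleftrightarrow> (\<exists>j<n div 2. \<exists>s\<in>{0, 1, 3, 7}. ?R j (j + s))"
    using powers[of "?R j" j for j] by (simp only: )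
  finally show ?thesis by (simp only: Bex_def) (rule iffI; elim exE conjE; intro exI conjI)
qed

lemma dominated_X_iff:
  assumes "periodic (int N) P" "N = n div 2" "j < N"
  shows "(1, j) \<in> vertices_of N P \<or> (\<exists>d\<in>vertices_of N P. knodel_adj 4 n d (1, j)) \<longleftrightarrow> covered P (X (int j))"
proof -
  have "(2, (j + s) mod N) \<in> vertices_of N P \<longleftrightarrow> Y (int j + int s) \<in> P" for s
    using assms(1,3) by (simp add: vertices_of_def zmod_int periodic_def)
  moreover have "(\<exists>d\<in>vertices_of N P. knodel_adj 4 n d (1, j))
      \<longleftrightarrow> (\<exists>s\<in>{0, 1, 3, 7}. (2, (j + s) mod N) \<in> vertices_of N P)"
    using assms(2,3) by (fastforce simp: knodel_adj_4_iff)
  ultimately show ?thesis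
    using assms(3) by (auto simp: covered_X vertices_of_def)
qed

lemma dominated_Y_iff:
  assumes "periodic (int N) P" "N = n div 2" "j < N"
  shows "(2, j) \<in> vertices_of N P \<or> (\<exists>d\<in>vertices_of N P. knodel_adj 4 n d (2, j)) \<longleftrightarrow> covered P (Y (int j))"
proof -
  have "(\<exists>i<N. (1, i) \<in> vertices_of N P \<and> j = (i + s) mod N) \<longleftrightarrow> X (int j - int s) \<in> P" for s
  proof
    assume "\<exists>i<N. (1, i) \<in> vertices_of N P \<and> j = (i + s) mod N"
    then obtain i where i: "X (int i) \<in> P" "j = (i + s) mod N" by (auto simp: vertices_of_def)
    then have "int j = (int i + int s) mod int N" by (simp add: zmod_int)
    with i(1) show "X (int j - int s) \<in> P" using periodic_diff(1)[OF assms(1)] by simp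
  next
    assume s: "X (int j - int s) \<in> P"
    \<comment> \<open>This solves \<open>j = (i + s) mod N\<close> for the position \<open>i\<close>
      on the first side.\<close>
    define i where "i = nat ((int j - int s) mod int N)"
    have i: "int i = (int j - int s) mod int N" "i < N" using assms(3) by (simp_all add: i_def nat_less_iff)
    then have "X (int i) \<in> P" using s assms(1) by (simp add: periodic_def)
    moreover have "int ((i + s) mod N) = int j"
      using assms(3) by (simp add: zmod_int i(1) mod_add_left_eq)
    ultimately show "\<exists>i<N. (1, i) \<in> vertices_of N P \<and> j = (i + s) mod N"
      using i(2) by (auto simp: vertices_of_def)
  qed
  moreover have "(\<exists>d\<in>vertices_of N P. knodel_adj 4 n d (2, j))
      \<longleftrightarrow> (\<exists>s\<in>{0, 1, 3, 7}. \<exists>i<N. (1, i) \<in> vertices_of N P \<and> j = (i + s) mod N)"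
  proof -
    have "knodel_adj 4 n d (2, j) \<longleftrightarrow> (\<exists>i s. s \<in> {0, 1, 3, 7} \<and> i < N \<and> d = (1, i) \<and> j = (i + s) mod N)" for d
      unfolding knodel_adj_4_iff assms(2) by simp
    then show ?thesis by (simp only: Bex_def) metis
  qed
  ultimately show ?thesis
    using assms(3) by (auto simp: covered_Y vertices_of_def)
qed

section \<open>Domination numbers and criticality in terms of patterns\<close>

lemma domination_number_le: "dominating V E D \<Longrightarrow> domination_number V E \<le> card D"
  unfolding domination_number_def by (rule Least_le) blast

lemma domination_number_attained: "\<exists>D. dominating V E D \<and> card D = domination_number V E"
proof -
  have "\<exists>k D. dominating V E D \<and> card D = k"
    by (auto simp: dominating_def intro!: exI[of _ V])
  then show ?thesis unfolding domination_number_def by (rule LeastI_ex)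
qed

lemma knodel_vertices_cases:
  assumes "v \<in> knodel_vertices n"
  obtains j where "v = (1, j)" "j < n div 2" | j where "v = (2, j)" "j < n div 2"
  using assms by (auto simp: knodel_vertices_def)

lemma vertices_of_subset: "vertices_of (n div 2) P \<subseteq> knodel_vertices n"
  by (auto simp: vertices_of_def knodel_vertices_def)

lemma dominating_vertices_of_iff:
  assumes "periodic (int (n div 2)) P"
  shows "dominating (knodel_vertices n) (knodel_adj 4 n) (vertices_of (n div 2) P)
    \<longleftrightarrow> (\<forall>j<n div 2. covered P (X (int j)) \<and> covered P (Y (int j)))"
proof -
  have "dominating (knodel_vertices n) (knodel_adj 4 n) (vertices_of (n div 2) P)
    \<longleftrightarrow> (\<forall>v\<in>knodel_vertices n. v \<in> vertices_of (n div 2) P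
      \<or> (\<exists>d\<in>vertices_of (n div 2) P. knodel_adj 4 n d v))"
    using vertices_of_subset by (auto simp: dominating_def)
  also have "\<dots> \<longleftrightarrow> (\<forall>j<n div 2. covered P (X (int j)) \<and> covered P (Y (int j)))"
    using dominated_X_iff[OF assms refl] dominated_Y_iff[OF assms refl]
    by (auto simp: knodel_vertices_def)
  finally show ?thesis .
qed

lemma covered_all:
  assumes "0 < N" "periodic (int N) P" "\<forall>j<N. covered P (X (int j)) \<and> covered P (Y (int j))"
  shows "covered P v"
proof -
  have "covered P (X j)" "covered P (Y j)" for j
  proof -
    obtain i where i: "j mod int N = int i" "i < N"
      using assms(1) by (metis nonneg_int_cases of_nat_0_less_iff of_nat_less_iff pos_mod_bound pos_mod_sign)
    with assms(3) have "covered P (X (j mod int N))" "covered P (Y (j mod int N))" by simp_all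
    then show "covered P (X j)" "covered P (Y j)" using covered_mod[OF assms(2)] by simp_all
  qed
  then show ?thesis by (cases v) auto
qed

lemma domination_number_knodel_ge:
  assumes "0 < n div 2"
    and "\<And>D. \<lbrakk>periodic (int (n div 2)) D; \<And>v. covered D v\<rbrakk>
      \<Longrightarrow> k \<le> num_X (int (n div 2)) D + num_Y (int (n div 2)) D"
  shows "k \<le> domination_number (knodel_vertices n) (knodel_adj 4 n)"
proof -
  obtain D where D: "dominating (knodel_vertices n) (knodel_adj 4 n) D"
      "card D = domination_number (knodel_vertices n) (knodel_adj 4 n)"
    using domination_number_attained by blast
  define P where "P = pattern_of (n div 2) D"
  have "D \<subseteq> {1, 2} \<times> {0..<n div 2}"
    using D(1) by (simp add: dominating_def knodel_vertices_def)
  then have P: "vertices_of (n div 2) P = D" "periodic (int (n div 2)) P"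
    unfolding P_def by (simp_all only: vertices_of_pattern_of periodic_pattern_of)
  have "\<forall>j<n div 2. covered P (X (int j)) \<and> covered P (Y (int j))"
    using dominating_vertices_of_iff[OF P(2)] D(1) unfolding P(1) by (rule iffD1)
  then have "covered P v" for v by (rule covered_all[OF assms(1) P(2)])
  then have "k \<le> num_X (int (n div 2)) P + num_Y (int (n div 2)) P" by (rule assms(2)[OF P(2)])
  then show ?thesis using card_vertices_of[of "n div 2" P] P(1) D(2) by simp
qed

lemma domination_number_knodel_le:
  assumes "periodic (int (n div 2)) P" "\<And>v. covered P v"
  shows "domination_number (knodel_vertices n) (knodel_adj 4 n)
    \<le> num_X (int (n div 2)) P + num_Y (int (n div 2)) P"
  using domination_number_le[of _ _ "vertices_of (n div 2) P"]
    dominating_vertices_of_iff[OF assms(1)] assms(2) card_vertices_of[of "n div 2" P] by metis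

text \<open>If deleting \<open>(1, 0)\<close> lowered the domination number, a minimum dominating
  set of the rest would be too small to dominate the whole graph. It would thus miss exactly
  \<open>(1, 0)\<close> and be a hole pattern with fewer than \<open>k\<close> vertices.\<close>

lemma not_gamma_critical_knodel:
  assumes "0 < n div 2" "domination_number (knodel_vertices n) (knodel_adj 4 n) \<le> k"
    and "\<And>D. hole (int (n div 2)) D \<Longrightarrow> k \<le> num_X (int (n div 2)) D + num_Y (int (n div 2)) D"
  shows "\<not> gamma_critical (knodel_vertices n) (knodel_adj 4 n)"
proof
  let ?V = "knodel_vertices n" and ?E = "knodel_adj 4 n" and ?N = "n div 2"
  assume "gamma_critical ?V ?E"
  moreover have "(1, 0) \<in> ?V" using assms(1) by (simp add: knodel_vertices_def)
  ultimately have "domination_number (?V - {(1, 0)}) ?E < domination_number ?V ?E"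
    by (simp add: gamma_critical_def)
  then obtain D where D: "dominating (?V - {(1, 0)}) ?E D" and less: "card D < domination_number ?V ?E"
    using domination_number_attained by metis
  define P where "P = pattern_of ?N D"
  have "D \<subseteq> {1, 2} \<times> {0..<?N}"
    using D by (auto simp: dominating_def knodel_vertices_def)
  then have P: "vertices_of ?N P = D" "periodic (int ?N) P"
    unfolding P_def by (simp_all only: vertices_of_pattern_of periodic_pattern_of)
  have dom: "v \<in> D \<or> (\<exists>d\<in>D. ?E d v)" if "v \<in> ?V" "v \<noteq> (1, 0)" for v
    using D that by (auto simp: dominating_def)
  have X: "covered P (X (int j))" if "j < ?N" "j \<noteq> 0" for j
    using dom[of "(1, j)"] that dominated_X_iff[OF P(2) refl that(1)] P(1)
    by (simp add: knodel_vertices_def)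
  have Y: "covered P (Y (int j))" if "j < ?N" for j
    using dom[of "(2, j)"] that dominated_Y_iff[OF P(2) refl that(1)] P(1)
    by (simp add: knodel_vertices_def)
  have "\<not> dominating ?V ?E D" using less domination_number_le leD by blast
  then have X0: "\<not> covered P (X 0)"
    using X Y dominating_vertices_of_iff[OF P(2)] P(1) by (metis of_nat_0)
  have res: "\<exists>i<?N. j mod int ?N = int i" for j
    using assms(1) by (metis nonneg_int_cases of_nat_0_less_iff of_nat_less_iff pos_mod_bound pos_mod_sign)
  have "hole (int ?N) P"
    unfolding hole_def
  proof (intro conjI allI impI)
    fix j assume "j mod int ?N \<noteq> 0"
    with res[of j] X show "covered P (X j)" by (metis covered_mod(1)[OF P(2)] of_nat_0)
  next
    fix j show "covered P (Y j)"
      using res[of j] Y by (metis covered_mod(2)[OF P(2)])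
  qed (use P X0 in auto)
  then have "k \<le> card D" using assms(3) card_vertices_of[of ?N P] P(1) by simp
  with less assms(2) show False by simp
qed

lemma dominating_diff_X:
  assumes "periodic (int (n div 2)) P" "X (int i) \<notin> P"
    and "\<And>j. \<lbrakk>j < n div 2; j \<noteq> i\<rbrakk> \<Longrightarrow> covered P (X (int j))" "\<And>j. covered P (Y j)"
  shows "dominating (knodel_vertices n - {(1, i)}) (knodel_adj 4 n) (vertices_of (n div 2) P)"
  unfolding dominating_def
proof (intro conjI ballI)
  show "vertices_of (n div 2) P \<subseteq> knodel_vertices n - {(1, i)}"
    using assms(2) by (auto simp: vertices_of_def knodel_vertices_def)
  fix v assume v: "v \<in> knodel_vertices n - {(1, i)} - vertices_of (n div 2) P"
  then have "v \<in> knodel_vertices n" by simp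
  then show "\<exists>d\<in>vertices_of (n div 2) P. knodel_adj 4 n d v"
  proof (cases rule: knodel_vertices_cases)
    case (1 j)
    then show ?thesis using v assms(3) dominated_X_iff[OF assms(1) refl, of j] by auto
  next
    case (2 j)
    then show ?thesis using v assms(4) dominated_Y_iff[OF assms(1) refl, of j] by auto
  qed
qed

lemma dominating_diff_Y:
  assumes "periodic (int (n div 2)) P" "Y (int i) \<notin> P"
    and "\<And>j. \<lbrakk>j < n div 2; j \<noteq> i\<rbrakk> \<Longrightarrow> covered P (Y (int j))" "\<And>j. covered P (X j)"
  shows "dominating (knodel_vertices n - {(2, i)}) (knodel_adj 4 n) (vertices_of (n div 2) P)"
  unfolding dominating_def
proof (intro conjI ballI)
  show "vertices_of (n div 2) P \<subseteq> knodel_vertices n - {(2, i)}"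
    using assms(2) by (auto simp: vertices_of_def knodel_vertices_def)
  fix v assume v: "v \<in> knodel_vertices n - {(2, i)} - vertices_of (n div 2) P"
  then have "v \<in> knodel_vertices n" by simp
  then show "\<exists>d\<in>vertices_of (n div 2) P. knodel_adj 4 n d v"
  proof (cases rule: knodel_vertices_cases)
    case (1 j)
    then show ?thesis using v assms(4) dominated_X_iff[OF assms(1) refl, of j] by auto
  next
    case (2 j)
    then show ?thesis using v assms(3) dominated_Y_iff[OF assms(1) refl, of j] by auto
  qed
qed

text \<open>The graph is vertex-transitive, so one small set covering everything except possibly
  \<open>X 0\<close>, and not containing it, serves for the deletion of every vertex.\<close>

lemma gamma_critical_knodel:
  assumes "0 < n div 2" "k < domination_number (knodel_vertices n) (knodel_adj 4 n)"
    and P: "periodic (int (n div 2)) P" "X 0 \<notin> P" "\<And>j. j mod int (n div 2) \<noteq> 0 \<Longrightarrow> covered P (X j)"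
      "\<And>j. covered P (Y j)"
    and "num_X (int (n div 2)) P + num_Y (int (n div 2)) P \<le> k"
  shows "gamma_critical (knodel_vertices n) (knodel_adj 4 n)"
  unfolding gamma_critical_def
proof
  let ?V = "knodel_vertices n" and ?E = "knodel_adj 4 n" and ?N = "n div 2"
  have m: "0 < int ?N" using assms(1) by simp
  \<comment> \<open>Both signs are needed, since the reflection reverses positions.\<close>
  have neq: "(int j - int i) mod int ?N \<noteq> 0" "(int i - int j) mod int ?N \<noteq> 0"
    if "i < ?N" "j < ?N" "j \<noteq> i" for i j
  proof -
    have "int i mod int ?N \<noteq> int j mod int ?N" using that by simp
    then show "(int j - int i) mod int ?N \<noteq> 0" "(int i - int j) mod int ?N \<noteq> 0"
      by (metis mod_eq_dvd_iff mod_eq_0_iff_dvd)+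
  qed
  fix u assume u: "u \<in> ?V"
  have "\<exists>D. dominating (?V - {u}) ?E D \<and> card D = num_X (int ?N) P + num_Y (int ?N) P"
    using u
  proof (cases rule: knodel_vertices_cases)
    case (1 i)
    let ?D = "shift (- int i) -` P"
    have "dominating (?V - {(1, i)}) ?E (vertices_of ?N ?D)"
    proof (rule dominating_diff_X)
      fix j assume "j < ?N" "j \<noteq> i"
      then show "covered ?D (X (int j))" using neq 1 P(3) by (simp add: covered_shift)
    qed (use P in \<open>simp_all add: periodic_shift covered_shift\<close>)
    then show ?thesis
      using card_vertices_of[of ?N ?D] num_shift[OF m P(1)] 1 by auto
  next
    case (2 i)
    \<comment> \<open>Composing reflection and translation takes \<open>Y j\<close> to
      \<open>X (i - j)\<close>, so the exceptional vertex moves from \<open>X 0\<close> to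
      \<open>Y i\<close>.\<close>
    let ?D = "flip -` (shift (int i) -` P)"
    have "dominating (?V - {(2, i)}) ?E (vertices_of ?N ?D)"
    proof (rule dominating_diff_Y)
      fix j assume "j < ?N" "j \<noteq> i"
      then show "covered ?D (Y (int j))" using neq 2 P(3) by (simp add: covered_shift covered_flip)
    qed (use P in \<open>simp_all add: periodic_shift periodic_flip covered_shift covered_flip\<close>)
    then show ?thesis
      using card_vertices_of[of ?N ?D] num_flip[OF m periodic_shift[OF P(1)]] num_shift[OF m P(1)] 2
      by (auto simp: add.commute)
  qed
  then show "domination_number (?V - {u}) ?E < domination_number ?V ?E"
    using domination_number_le[of "?V - {u}" ?E] assms(2,7) by fastforce
qed

section \<open>Upper bounds\<close>

definition pattern :: "int \<Rightarrow> (int \<Rightarrow> bool) \<Rightarrow> (int \<Rightarrow> bool) \<Rightarrow> vertex set" where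
  "pattern m A B = X ` {j. A (j mod m)} \<union> Y ` {j. B (j mod m)}"

lemma in_pattern [simp]:
  "X j \<in> pattern m A B \<longleftrightarrow> A (j mod m)" "Y j \<in> pattern m A B \<longleftrightarrow> B (j mod m)"
  by (auto simp: pattern_def)

lemma periodic_pattern: "periodic m (pattern m A B)"
  by (simp add: periodic_def)

lemma num_pattern:
  "num_X m (pattern m A B) = card {j \<in> {0..<m}. A j}"
  "num_Y m (pattern m A B) = card {j \<in> {0..<m}. B j}"
proof -
  have "(\<Sum>j\<in>{0..<m}. of_bool (Q (j mod m))) = card {j \<in> {0..<m}. Q j}" for Q
  proof -
    have "(\<Sum>j\<in>{0..<m}. of_bool (Q (j mod m))) = (\<Sum>j\<in>{0..<m}. of_bool (Q j) :: nat)"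
      by (rule sum.cong) auto
    then show ?thesis by (simp add: Int_def)
  qed
  then show "num_X m (pattern m A B) = card {j \<in> {0..<m}. A j}"
    "num_Y m (pattern m A B) = card {j \<in> {0..<m}. B j}"
    by (simp_all only: num_X_def num_Y_def in_pattern)
qed

text \<open>Reduction modulo \<open>m\<close> for positions off by at most one period, by
  comparisons alone. With \<open>m\<close> of the form 5q + c this leaves only linear arithmetic and
  residues modulo 5.\<close>

definition wrap :: "int \<Rightarrow> int \<Rightarrow> int" where
  "wrap m i = (if i < 0 then i + m else if i < m then i else i - m)"

lemma mod_eq_wrap:
  assumes "- m \<le> i" "i < 2 * m"
  shows "i mod m = wrap m i"
proof -
  consider "i < 0" | "0 \<le> i" "i < m" | "m \<le> i" by linarith
  then show ?thesis
  proof cases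
    case 1
    then have "(i + m) mod m = i + m" using assms by (intro mod_pos_pos_trivial) auto
    with 1 show ?thesis by (simp add: wrap_def)
  next
    case 2
    then show ?thesis by (simp add: wrap_def)
  next
    case 3
    then have "(i - m) mod m = i - m" using assms by (intro mod_pos_pos_trivial) auto
    with 3 assms show ?thesis by (simp add: wrap_def)
  qed
qed

definition covers_X :: "int \<Rightarrow> (int \<Rightarrow> bool) \<Rightarrow> (int \<Rightarrow> bool) \<Rightarrow> int \<Rightarrow> bool" where
  "covers_X m A B j \<longleftrightarrow> A j \<or> B j \<or> B (wrap m (j + 1)) \<or> B (wrap m (j + 3)) \<or> B (wrap m (j + 7))"

definition covers_Y :: "int \<Rightarrow> (int \<Rightarrow> bool) \<Rightarrow> (int \<Rightarrow> bool) \<Rightarrow> int \<Rightarrow> bool" where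
  "covers_Y m A B j \<longleftrightarrow> B j \<or> A j \<or> A (wrap m (j - 1)) \<or> A (wrap m (j - 3)) \<or> A (wrap m (j - 7))"

lemma covered_pattern:
  assumes "8 \<le> m"
  shows "covered (pattern m A B) (X j) \<longleftrightarrow> covers_X m A B (j mod m)"
    "covered (pattern m A B) (Y j) \<longleftrightarrow> covers_Y m A B (j mod m)"
proof -
  define i where "i = j mod m"
  have i: "0 \<le> i" "i < m" using assms by (simp_all add: i_def)
  have "(i + s) mod m = wrap m (i + s)" "(i - s) mod m = wrap m (i - s)" if "0 \<le> s" "s \<le> 7" for s
    using i assms that by (auto intro!: mod_eq_wrap)
  note wraps = this[of 1] this[of 3] this[of 7]
  have "covered (pattern m A B) (X i) \<longleftrightarrow> covers_X m A B i"
    "covered (pattern m A B) (Y i) \<longleftrightarrow> covers_Y m A B i"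
    using wraps i by (simp_all add: covered_X covered_Y covers_X_def covers_Y_def)
  then show "covered (pattern m A B) (X j) \<longleftrightarrow> covers_X m A B (j mod m)"
    "covered (pattern m A B) (Y j) \<longleftrightarrow> covers_Y m A B (j mod m)"
    by (simp_all add: i_def covered_mod[OF periodic_pattern])
qed

lemma domination_number_knodel_le_pattern:
  assumes "n = 2 * nat m" "8 \<le> m" "\<And>j. \<lbrakk>0 \<le> j; j < m\<rbrakk> \<Longrightarrow> covers_X m A B j \<and> covers_Y m A B j"
    and "card {j \<in> {0..<m}. A j} + card {j \<in> {0..<m}. B j} \<le> k"
  shows "domination_number (knodel_vertices n) (knodel_adj 4 n) \<le> k"
proof -
  have m: "int (n div 2) = m" using assms(1,2) by simp
  have "covered (pattern m A B) v" for v
    using assms(2,3) by (cases v) (simp_all add: covered_pattern)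
  then show ?thesis
    using domination_number_knodel_le[of n "pattern m A B"] assms(4)
    by (simp add: m periodic_pattern num_pattern)
qed

lemma gamma_critical_knodel_pattern:
  assumes "n = 2 * nat m" "8 \<le> m" "k < domination_number (knodel_vertices n) (knodel_adj 4 n)"
    and "\<And>j. \<lbrakk>0 < j; j < m\<rbrakk> \<Longrightarrow> covers_X m A B j" "\<And>j. \<lbrakk>0 \<le> j; j < m\<rbrakk> \<Longrightarrow> covers_Y m A B j"
    and "\<not> A 0" "card {j \<in> {0..<m}. A j} + card {j \<in> {0..<m}. B j} \<le> k"
  shows "gamma_critical (knodel_vertices n) (knodel_adj 4 n)"
proof (rule gamma_critical_knodel)
  have m: "int (n div 2) = m" using assms(1,2) by simp
  show "0 < n div 2" using assms(1,2) by simp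
  show "periodic (int (n div 2)) (pattern m A B)" by (simp add: m periodic_pattern)
  show "num_X (int (n div 2)) (pattern m A B) + num_Y (int (n div 2)) (pattern m A B) \<le> k"
    using assms(7) by (simp add: m num_pattern)
  fix j
  show "covered (pattern m A B) (Y j)" using assms(2,5) by (simp add: covered_pattern)
  assume "j mod int (n div 2) \<noteq> 0"
  then have "0 < j mod m" using assms(2) pos_mod_sign[of m j] unfolding m by linarith
  then show "covered (pattern m A B) (X j)" using assms(2,4) by (simp add: covered_pattern)
qed (use assms in auto)

section \<open>Patterns of period 5 with a defect\<close>

lemma card_progression_le:
  fixes c :: int
  assumes "\<And>j. j \<in> S \<Longrightarrow> j mod 5 = c mod 5 \<and> c \<le> j \<and> j < c + 5 * int k"
  shows "card S \<le> k"
proof -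
  have "S \<subseteq> (\<lambda>i. c + 5 * int i) ` {..<k}"
  proof
    fix j assume "j \<in> S"
    from assms[OF this] have j: "5 dvd j - c" "c \<le> j" "j < c + 5 * int k"
      by (auto simp: mod_eq_dvd_iff)
    then obtain t where "j - c = 5 * t" by auto
    with j have "j = c + 5 * int (nat t)" "nat t < k" by auto
    then show "j \<in> (\<lambda>i. c + 5 * int i) ` {..<k}" by blast
  qed
  then have "card S \<le> card ((\<lambda>i. c + 5 * int i) ` {..<k})" by (intro card_mono) auto
  also have "\<dots> \<le> k" using card_image_le[of "{..<k}"] by simp
  finally show ?thesis .
qed

lemma card_insert_progression_le:
  fixes c :: int
  assumes "finite E" "\<And>j. j \<in> S \<Longrightarrow> j \<in> E \<or> j mod 5 = c mod 5 \<and> c \<le> j \<and> j < c + 5 * int k"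
  shows "card S \<le> card E + k"
proof -
  have "S \<subseteq> E \<union> (S - E)" by blast
  then have "card S \<le> card (E \<union> (S - E))"
    using finite_subset[of S "E \<union> {c..<c + 5 * int k}"] assms by (intro card_mono) fastforce+
  also have "\<dots> \<le> card E + card (S - E)" by (rule card_Un_le)
  also have "card (S - E) \<le> k" using assms(2) by (intro card_progression_le[of _ c]) auto
  finally show ?thesis by simp
qed

text \<open>Away from the seven positions at either end no offset wraps around, and writing
  \<open>j = 5 * t + r\<close> makes all residues modulo 5 explicit.\<close>

lemma residue_cases:
  fixes m j :: int
  assumes "0 \<le> j" "j < m"
  obtains t r where "r \<in> {7, 8, 9, 10, 11}" "0 \<le> t" "j = 5 * t + r" "j < m - 7"
    | "j \<in> {0, 1, 2, 3, 4, 5, 6}" | i where "i \<in> {1, 2, 3, 4, 5, 6, 7}" "j = m - i"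
proof -
  have "7 \<le> j \<and> j < m - 7 \<or> j \<in> {0, 1, 2, 3, 4, 5, 6} \<or> m - j \<in> {1, 2, 3, 4, 5, 6, 7}"
    unfolding insert_iff empty_iff using assms by presburger
  then consider "7 \<le> j" "j < m - 7" | "j \<in> {0, 1, 2, 3, 4, 5, 6}" | "m - j \<in> {1, 2, 3, 4, 5, 6, 7}"
    by blast
  then show ?thesis
  proof cases
    case 1
    have "7 + (j - 7) mod 5 \<in> {7, 8, 9, 10, 11}"
      unfolding insert_iff empty_iff by presburger
    moreover have "j = 5 * ((j - 7) div 5) + (7 + (j - 7) mod 5)" by simp
    ultimately show ?thesis using that(1)[of "7 + (j - 7) mod 5" "(j - 7) div 5"] 1 by simp
  next
    case 2
    then show ?thesis by (rule that(2))
  next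
    case 3
    then show ?thesis using that(3)[of "m - j"] by simp
  qed
qed

text \<open>The perfect pattern behind all the others. Modulo 5 the offsets are 0, 1, 3, 2, so
  \<open>Y\<close> vertices of residue b cover the \<open>X\<close> residues b, b - 1, b - 2, b - 3,
  and choosing \<open>X\<close> at residue b + 1 supplies the missing class. The same choice covers
  each \<open>Y\<close> residue exactly once.\<close>

lemma pattern_covers_0_mod_5:
  fixes q m :: int
  assumes "m = 5 * q + 0" "2 \<le> q" "0 \<le> j" "j < m"
  defines "A \<equiv> \<lambda>j. j mod 5 = 0" and "B \<equiv> \<lambda>j. j mod 5 = 4"
  shows "covers_X m A B j" "covers_Y m A B j"
proof -
  have "(covers_X m A B j) \<and> covers_Y m A B j"
  proof (cases "q = 2")
    case True
    then have "m = 10" using assms(1) by simp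
    moreover from this assms(3,4) have "j \<in> {0, 1, 2, 3, 4, 5, 6, 7, 8, 9}"
      unfolding insert_iff empty_iff by presburger
    ultimately show ?thesis
      unfolding covers_X_def covers_Y_def A_def B_def wrap_def by (elim insertE emptyE; simp)
  next
    case False
    \<comment> \<open>Since \<open>m\<close> is now at least 15, the sign of \<open>p\<close>
      decides every comparison in \<open>wrap\<close> near the two ends.\<close>
    define p where "p = q - 3"
    have m: "m = 5 * p + 15" "0 \<le> p" using False assms(1,2) by (simp_all add: p_def)
    from assms(3,4) show ?thesis
    proof (cases rule: residue_cases)
      case (1 t r)
      then show ?thesis using m(2)
        unfolding covers_X_def covers_Y_def A_def B_def wrap_def m(1)
        by (elim insertE emptyE; simp)
    next
      case 2
      then show ?thesis using m(2)
        unfolding covers_X_def covers_Y_def A_def B_def wrap_def m(1)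
        by (elim insertE emptyE; simp)
    next
      case (3 i)
      then show ?thesis using m(2)
        unfolding covers_X_def covers_Y_def A_def B_def wrap_def m(1)
        by (elim insertE emptyE; simp)
    qed
  qed
  then show "covers_X m A B j" "covers_Y m A B j" by simp_all
qed

text \<open>The perfect pattern with b = 4; the extra \<open>Y 2\<close> repairs the seam.\<close>

lemma pattern_covers_2_mod_5:
  fixes q m :: int
  assumes "m = 5 * q + 2" "2 \<le> q" "0 \<le> j" "j < m"
  defines "A \<equiv> \<lambda>j. j mod 5 = 0" and "B \<equiv> \<lambda>j. j = 2 \<or> j mod 5 = 4"
  shows "covers_X m A B j" "covers_Y m A B j"
proof -
  have "(covers_X m A B j) \<and> covers_Y m A B j"
  proof (cases "q = 2")
    case True
    then have "m = 12" using assms(1) by simp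
    moreover from this assms(3,4) have "j \<in> {0, 1, 2, 3, 4, 5, 6, 7, 8, 9, 10, 11}"
      unfolding insert_iff empty_iff by presburger
    ultimately show ?thesis
      unfolding covers_X_def covers_Y_def A_def B_def wrap_def by (elim insertE emptyE; simp)
  next
    case False
    define p where "p = q - 3"
    have m: "m = 5 * p + 17" "0 \<le> p" using False assms(1,2) by (simp_all add: p_def)
    from assms(3,4) show ?thesis
    proof (cases rule: residue_cases)
      case (1 t r)
      then show ?thesis using m(2)
        unfolding covers_X_def covers_Y_def A_def B_def wrap_def m(1)
        by (elim insertE emptyE; simp)
    next
      case 2
      then show ?thesis using m(2)
        unfolding covers_X_def covers_Y_def A_def B_def wrap_def m(1)
        by (elim insertE emptyE; simp)
    next
      case (3 i)
      then show ?thesis using m(2)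
        unfolding covers_X_def covers_Y_def A_def B_def wrap_def m(1)
        by (elim insertE emptyE; simp)
    qed
  qed
  then show "covers_X m A B j" "covers_Y m A B j" by simp_all
qed

text \<open>The perfect pattern with b = 0 from position 6 on; near 0 it is replaced by
  \<open>X 0\<close>, \<open>X 4\<close>, \<open>X 5\<close> and \<open>Y 2\<close>.\<close>

lemma pattern_covers_3_mod_5:
  fixes q m :: int
  assumes "m = 5 * q + 3" "3 \<le> q" "0 \<le> j" "j < m"
  defines "A \<equiv> \<lambda>j. j = 0 \<or> j = 4 \<or> j = 5 \<or> 6 \<le> j \<and> j mod 5 = 1" and "B \<equiv> \<lambda>j. j = 2 \<or> 10 \<le> j \<and> j mod 5 = 0"
  shows "covers_X m A B j" "covers_Y m A B j"
proof -
  have "(covers_X m A B j) \<and> covers_Y m A B j"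
  proof -
    define p where "p = q - 3"
    have m: "m = 5 * p + 18" "0 \<le> p" using assms(1,2) by (simp_all add: p_def)
    from assms(3,4) show ?thesis
    proof (cases rule: residue_cases)
      case (1 t r)
      then show ?thesis using m(2)
        unfolding covers_X_def covers_Y_def A_def B_def wrap_def m(1)
        by (elim insertE emptyE; simp; arith?)
    next
      case 2
      then show ?thesis using m(2)
        unfolding covers_X_def covers_Y_def A_def B_def wrap_def m(1)
        by (elim insertE emptyE; simp; arith?)
    next
      case (3 i)
      then show ?thesis using m(2)
        unfolding covers_X_def covers_Y_def A_def B_def wrap_def m(1)
        by (elim insertE emptyE; simp; arith?)
    qed
  qed
  then show "covers_X m A B j" "covers_Y m A B j" by simp_all
qed

text \<open>The perfect pattern with b = 3, with \<open>Y 3\<close> dropped and \<open>X 3\<close>,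
  \<open>Y 2\<close> added; only \<open>X 0\<close> is exempt.\<close>

lemma pattern_covers_1_mod_5:
  fixes q m :: int
  assumes "m = 5 * q + 1" "2 \<le> q" "0 \<le> j" "j < m"
  defines "A \<equiv> \<lambda>j. j = 3 \<or> j mod 5 = 4" and "B \<equiv> \<lambda>j. j = 2 \<or> 8 \<le> j \<and> j mod 5 = 3"
  shows "0 < j \<Longrightarrow> covers_X m A B j" "covers_Y m A B j"
proof -
  have "(0 < j \<longrightarrow> covers_X m A B j) \<and> covers_Y m A B j"
  proof (cases "q = 2")
    case True
    then have "m = 11" using assms(1) by simp
    moreover from this assms(3,4) have "j \<in> {0, 1, 2, 3, 4, 5, 6, 7, 8, 9, 10}"
      unfolding insert_iff empty_iff by presburger
    ultimately show ?thesis
      unfolding covers_X_def covers_Y_def A_def B_def wrap_def by (elim insertE emptyE; simp)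
  next
    case False
    define p where "p = q - 3"
    have m: "m = 5 * p + 16" "0 \<le> p" using False assms(1,2) by (simp_all add: p_def)
    from assms(3,4) show ?thesis
    proof (cases rule: residue_cases)
      case (1 t r)
      then show ?thesis using m(2)
        unfolding covers_X_def covers_Y_def A_def B_def wrap_def m(1)
        by (elim insertE emptyE; simp)
    next
      case 2
      then show ?thesis using m(2)
        unfolding covers_X_def covers_Y_def A_def B_def wrap_def m(1)
        by (elim insertE emptyE; simp)
    next
      case (3 i)
      then show ?thesis using m(2)
        unfolding covers_X_def covers_Y_def A_def B_def wrap_def m(1)
        by (elim insertE emptyE; simp)
    qed
  qed
  then show "0 < j \<Longrightarrow> covers_X m A B j" "covers_Y m A B j" by simp_all
qed

text \<open>The perfect pattern with b = 1, altered on both sides of the seam: \<open>Y 1\<close>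
  and \<open>X (m - 2)\<close> are dropped, while \<open>X 1\<close>, \<open>X (m - 8)\<close> and
  \<open>Y (m - 2)\<close> are added. Only \<open>X 0\<close> is exempt.\<close>

lemma pattern_covers_4_mod_5:
  fixes q m :: int
  assumes "m = 5 * q + 4" "3 \<le> q" "0 \<le> j" "j < m"
  defines "A \<equiv> \<lambda>j. j = 1 \<or> j = m - 8 \<or> j mod 5 = 2 \<and> j \<le> m - 7" and "B \<equiv> \<lambda>j. j = m - 2 \<or> 6 \<le> j \<and> j mod 5 = 1"
  shows "0 < j \<Longrightarrow> covers_X m A B j" "covers_Y m A B j"
proof -
  have "(0 < j \<longrightarrow> covers_X m A B j) \<and> covers_Y m A B j"
  proof -
    define p where "p = q - 3"
    have m: "m = 5 * p + 19" "0 \<le> p" using assms(1,2) by (simp_all add: p_def)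
    from assms(3,4) show ?thesis
    proof (cases rule: residue_cases)
      case (1 t r)
      then show ?thesis using m(2)
        unfolding covers_X_def covers_Y_def A_def B_def wrap_def m(1)
        by (elim insertE emptyE; simp)
    next
      case 2
      then show ?thesis using m(2)
        unfolding covers_X_def covers_Y_def A_def B_def wrap_def m(1)
        by (elim insertE emptyE; simp)
    next
      case (3 i)
      then show ?thesis using m(2)
        unfolding covers_X_def covers_Y_def A_def B_def wrap_def m(1)
        by (elim insertE emptyE; simp)
    qed
  qed
  then show "0 < j \<Longrightarrow> covers_X m A B j" "covers_Y m A B j" by simp_all
qed

section \<open>Criticality in each residue class\<close>

lemma gamma_critical_1:
  assumes "n = 2 * (5 * q + 1)" "2 \<le> q"
  shows "gamma_critical (knodel_vertices n) (knodel_adj 4 n)"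
proof -
  let ?m = "5 * int q + 1"
  let ?A = "\<lambda>j. j = 3 \<or> j mod 5 = 4" and ?B = "\<lambda>j. j = 2 \<or> 8 \<le> j \<and> j mod 5 = (3::int)"
  have m: "int (n div 2) = ?m" "n = 2 * nat ?m" "8 \<le> ?m" using assms by (simp_all add: nat_add_distrib nat_mult_distrib)
  have "2 * q + 2 \<le> domination_number (knodel_vertices n) (knodel_adj 4 n)"
  proof (rule domination_number_knodel_ge)
    fix D assume "periodic (int (n div 2)) D" "\<And>v. covered D v"
    then show "2 * q + 2 \<le> num_X (int (n div 2)) D + num_Y (int (n div 2)) D"
      unfolding m(1) by (rule covered_lower_bound_1[OF refl assms(2)])
  qed (use assms in simp)
  \<comment> \<open>The witness has at most (1 + q) + (1 + (q - 1)) = 2q + 1 vertices, one below the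
    lower bound just shown.\<close>
  moreover have "card {j \<in> {0..<?m}. ?A j} \<le> card {3::int} + q"
    by (rule card_insert_progression_le[of _ _ 4]) (simp, (auto; presburger))
  moreover have "card {j \<in> {0..<?m}. ?B j} \<le> card {2::int} + (q - 1)"
    by (rule card_insert_progression_le[of _ _ 8]) (simp, (use assms(2) in \<open>auto; presburger\<close>))
  ultimately show ?thesis
    using pattern_covers_1_mod_5[OF refl] assms(2)
    by (intro gamma_critical_knodel_pattern[OF m(2,3), of "2 * q + 1" ?A ?B]) auto
qed

text \<open>On this short cycle six vertices, in no pattern of period 5, cover everything except
  possibly \<open>X 0\<close>, while domination takes at least seven.\<close>

lemma gamma_critical_13: "gamma_critical (knodel_vertices 26) (knodel_adj 4 26)"
proof -
  let ?A = "\<lambda>j. j \<in> {1, 2, 6}" and ?B = "\<lambda>j. j \<in> {10, 11, 12::int}"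
  have "7 \<le> domination_number (knodel_vertices 26) (knodel_adj 4 26)"
    by (rule domination_number_knodel_ge) (use covered_lower_bound_13 in simp_all)
  moreover have "card {j \<in> {0..<13}. ?A (j::int)} \<le> card {1, 2, 6::int} + 0"
    by (rule card_insert_progression_le) auto
  moreover have "card {j \<in> {0..<13}. ?B j} \<le> card {10, 11, 12::int} + 0"
    by (rule card_insert_progression_le) auto
  moreover have "(0 < j \<longrightarrow> covers_X 13 ?A ?B j) \<and> covers_Y 13 ?A ?B j" if "0 \<le> j" "j < 13" for j
  proof -
    have "j \<in> {0, 1, 2, 3, 4, 5, 6, 7, 8, 9, 10, 11, 12}"
      using that unfolding insert_iff empty_iff by presburger
    then show ?thesis
      unfolding covers_X_def covers_Y_def wrap_def by (elim insertE emptyE; simp)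
  qed
  ultimately show ?thesis
    by (intro gamma_critical_knodel_pattern[of _ 13 6 ?A ?B]) auto
qed

text \<open>The witness has at most (2 + q) + (1 + q) = 2q + 3 vertices, one below the lower
  bound.\<close>

lemma gamma_critical_4:
  assumes "n = 2 * (5 * q + 4)" "3 \<le> q"
  shows "gamma_critical (knodel_vertices n) (knodel_adj 4 n)"
proof -
  let ?m = "5 * int q + 4"
  let ?A = "\<lambda>j. j = 1 \<or> j = ?m - 8 \<or> j mod 5 = 2 \<and> j \<le> ?m - 7"
    and ?B = "\<lambda>j. j = ?m - 2 \<or> 6 \<le> j \<and> j mod 5 = 1"
  have m: "int (n div 2) = ?m" "n = 2 * nat ?m" "8 \<le> ?m" using assms by (simp_all add: nat_add_distrib nat_mult_distrib)
  have "2 * q + 4 \<le> domination_number (knodel_vertices n) (knodel_adj 4 n)"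
  proof (rule domination_number_knodel_ge)
    fix D assume "periodic (int (n div 2)) D" "\<And>v. covered D v"
    then show "2 * q + 4 \<le> num_X (int (n div 2)) D + num_Y (int (n div 2)) D"
      unfolding m(1) by (rule covered_lower_bound_4[OF refl assms(2)])
  qed (use assms in simp)
  moreover have "card {j \<in> {0..<?m}. ?A j} \<le> card {1, ?m - 8} + q"
    by (rule card_insert_progression_le[of _ _ 2]) (simp, (auto; presburger))
  moreover have "card {1, ?m - 8} \<le> 2" by (simp add: card_insert_if)
  moreover have "card {j \<in> {0..<?m}. ?B j} \<le> card {?m - 2} + q"
    by (rule card_insert_progression_le[of _ _ 6]) (simp, (auto; presburger))
  moreover have "card {?m - 2} = 1" by simp
  ultimately show ?thesis
    using pattern_covers_4_mod_5[OF refl] assms(2)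
    by (intro gamma_critical_knodel_pattern[OF m(2,3), of "2 * q + 3" ?A ?B]) auto
qed

text \<open>Counting alone suffices: a hole pattern satisfies 5(\<alpha> + \<beta>) \<ge> 10q - 1
  and so has at least 2q vertices, as many as the perfect pattern.\<close>

lemma not_gamma_critical_0:
  assumes "n = 2 * (5 * q)" "2 \<le> q"
  shows "\<not> gamma_critical (knodel_vertices n) (knodel_adj 4 n)"
proof -
  let ?m = "5 * int q"
  let ?A = "\<lambda>j. j mod 5 = 0" and ?B = "\<lambda>j. j mod 5 = (4::int)"
  have m: "int (n div 2) = ?m" "n = 2 * nat ?m" "8 \<le> ?m" using assms by (simp_all add: nat_mult_distrib)
  have "card {j \<in> {0..<?m}. ?A j} \<le> q"
    by (rule card_progression_le[of _ 0]) (auto; presburger)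
  moreover have "card {j \<in> {0..<?m}. ?B j} \<le> q"
    by (rule card_progression_le[of _ 4]) (auto; presburger)
  ultimately have "domination_number (knodel_vertices n) (knodel_adj 4 n) \<le> 2 * q"
    using pattern_covers_0_mod_5 assms(2)
    by (intro domination_number_knodel_le_pattern[OF m(2,3), of ?A ?B]) auto
  moreover have "2 * q \<le> num_X ?m D + num_Y ?m D" if "hole ?m D" for D
    using hole_bounds[OF _ that] assms(2) by simp
  ultimately show ?thesis
    using assms by (intro not_gamma_critical_knodel[of n "2 * q"]) (simp_all only: m(1), simp)
qed

lemma not_gamma_critical_2:
  assumes "n = 2 * (5 * q + 2)" "2 \<le> q"
  shows "\<not> gamma_critical (knodel_vertices n) (knodel_adj 4 n)"
proof -
  let ?m = "5 * int q + 2"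
  let ?A = "\<lambda>j. j mod 5 = 0" and ?B = "\<lambda>j. j = 2 \<or> j mod 5 = (4::int)"
  have m: "int (n div 2) = ?m" "n = 2 * nat ?m" "8 \<le> ?m" using assms by (simp_all add: nat_add_distrib nat_mult_distrib)
  have "card {j \<in> {0..<?m}. ?A j} \<le> q + 1"
    by (rule card_progression_le[of _ 0]) (auto; presburger)
  moreover have "card {j \<in> {0..<?m}. ?B j} \<le> card {2::int} + q"
    by (rule card_insert_progression_le[of _ _ 4]) (simp, (auto; presburger))
  ultimately have "domination_number (knodel_vertices n) (knodel_adj 4 n) \<le> 2 * q + 2"
    using pattern_covers_2_mod_5[OF refl] assms(2)
    by (intro domination_number_knodel_le_pattern[OF m(2,3), of ?A ?B]) auto
  then show ?thesis
  proof (rule not_gamma_critical_knodel[rotated])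
    fix D assume "hole (int (n div 2)) D"
    then show "2 * q + 2 \<le> num_X (int (n div 2)) D + num_Y (int (n div 2)) D"
      unfolding m(1) by (rule hole_lower_bound_2[OF refl assms(2)])
  qed (use assms in simp)
qed

text \<open>The pattern has at most (3 + q) + (1 + (q - 1)) = 2q + 3 vertices, and a hole pattern
  needs as many.\<close>

lemma not_gamma_critical_3:
  assumes "n = 2 * (5 * q + 3)" "4 \<le> q"
  shows "\<not> gamma_critical (knodel_vertices n) (knodel_adj 4 n)"
proof -
  let ?m = "5 * int q + 3"
  let ?A = "\<lambda>j. j = 0 \<or> j = 4 \<or> j = 5 \<or> 6 \<le> j \<and> j mod 5 = 1"
    and ?B = "\<lambda>j. j = 2 \<or> 10 \<le> j \<and> j mod 5 = (0::int)"
  have m: "int (n div 2) = ?m" "n = 2 * nat ?m" "8 \<le> ?m" using assms by (simp_all add: nat_add_distrib nat_mult_distrib)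
  have "card {j \<in> {0..<?m}. ?A j} \<le> card {0, 4, 5::int} + q"
    by (rule card_insert_progression_le[of _ _ 6]) (simp, (auto; presburger))
  moreover have "card {j \<in> {0..<?m}. ?B j} \<le> card {2::int} + (q - 1)"
    by (rule card_insert_progression_le[of _ _ 10]) (simp, (use assms(2) in \<open>auto; presburger\<close>))
  ultimately have "domination_number (knodel_vertices n) (knodel_adj 4 n) \<le> 2 * q + 3"
    using pattern_covers_3_mod_5[OF refl] assms(2)
    by (intro domination_number_knodel_le_pattern[OF m(2,3), of ?A ?B]) auto
  then show ?thesis
  proof (rule not_gamma_critical_knodel[rotated])
    fix D assume "hole (int (n div 2)) D"
    then show "2 * q + 3 \<le> num_X (int (n div 2)) D + num_Y (int (n div 2)) D"
      unfolding m(1) by (rule hole_lower_bound_3[OF refl assms(2)])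
  qed (use assms in simp)
qed

text \<open>With explicit lists the covering condition is a closed term and can be evaluated;
  repeated entries would only decrease the cardinality.\<close>

lemma domination_number_le_lists:
  assumes "n = 2 * nat m" "8 \<le> m"
    and "\<forall>j\<in>{0..<m}. covers_X m (\<lambda>j. j \<in> set xs) (\<lambda>j. j \<in> set ys) j
      \<and> covers_Y m (\<lambda>j. j \<in> set xs) (\<lambda>j. j \<in> set ys) j"
  shows "domination_number (knodel_vertices n) (knodel_adj 4 n) \<le> length xs + length ys"
proof (rule domination_number_knodel_le_pattern[OF assms(1,2)])
  show "card {j \<in> {0..<m}. j \<in> set xs} + card {j \<in> {0..<m}. j \<in> set ys} \<le> length xs + length ys"
    by (intro add_mono order_trans[OF card_mono card_length]) auto
qed (use assms(3) in auto)

text \<open>For \<open>m\<close> = 8, 9 and 18 counting bounds hole patterns well enough;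
  \<open>m\<close> = 14 uses the search. The lists for 18 are those for 9 together with their
  translates by 9, which gives one vertex fewer than the pattern in
  \<open>not_gamma_critical_3\<close> would.\<close>

lemma not_gamma_critical_small:
  assumes "n \<in> {16, 18, 28, 36}"
  shows "\<not> gamma_critical (knodel_vertices n) (knodel_adj 4 n)"
proof -
  have "domination_number (knodel_vertices 16) (knodel_adj 4 16) \<le> length [0, 3::int] + length [2, 5::int]"
    by (rule domination_number_le_lists[of _ 8]) (simp, simp, code_simp)
  moreover have "domination_number (knodel_vertices 18) (knodel_adj 4 18) \<le> length [0, 8::int] + length [4, 5::int]"
    by (rule domination_number_le_lists[of _ 9]) (simp, simp, code_simp)
  moreover have "domination_number (knodel_vertices 28) (knodel_adj 4 28)
      \<le> length [0, 3, 6, 12::int] + length [2, 8, 11::int]"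
    by (rule domination_number_le_lists[of _ 14]) (simp, simp, code_simp)
  moreover have "domination_number (knodel_vertices 36) (knodel_adj 4 36)
      \<le> length [0, 8, 9, 17::int] + length [4, 5, 13, 14::int]"
    by (rule domination_number_le_lists[of _ 18]) (simp, simp, code_simp)
  moreover have "4 \<le> num_X 8 D + num_Y 8 D" if "hole 8 D" for D
    using hole_bounds[OF _ that] by (simp; arith)
  moreover have "4 \<le> num_X 9 D + num_Y 9 D" if "hole 9 D" for D
    using hole_bounds[OF _ that] by simp
  moreover have "8 \<le> num_X 18 D + num_Y 18 D" if "hole 18 D" for D
    using hole_bounds[OF _ that] by (simp; arith)
  ultimately have "\<not> gamma_critical (knodel_vertices 16) (knodel_adj 4 16)"
     "\<not> gamma_critical (knodel_vertices 18) (knodel_adj 4 18)"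
     "\<not> gamma_critical (knodel_vertices 28) (knodel_adj 4 28)"
     "\<not> gamma_critical (knodel_vertices 36) (knodel_adj 4 36)"
    using not_gamma_critical_knodel[of 16 4] not_gamma_critical_knodel[of 18 4]
      not_gamma_critical_knodel[of 28 7] not_gamma_critical_knodel[of 36 8] hole_lower_bound_14
    by simp_all
  then show ?thesis using assms by auto
qed

theorem theorem4p5:
  fixes n :: nat
  assumes "even n" and "n \<ge> 16"
  shows "gamma_critical (knodel_vertices n) (knodel_adj 4 n) \<longleftrightarrow>
           (n = 26 \<or> (n \<ge> 22 \<and> n mod 10 = 2) \<or> (n \<ge> 38 \<and> n mod 10 = 8))"
    (is "_ \<longleftrightarrow> ?R")
proof -
  define q where "q = n div 10"
  \<comment> \<open>The lengths \<open>n div 2\<close> below the thresholds of the general lemmas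
    are 8, 9, 13, 14 and 18.\<close>
  have cases: "n = 2 * (5 * q) \<and> 2 \<le> q \<or> n = 2 * (5 * q + 1) \<and> 2 \<le> q
      \<or> n = 2 * (5 * q + 2) \<and> 2 \<le> q \<or> n = 2 * (5 * q + 3) \<and> 4 \<le> q \<or> n = 26
      \<or> n = 2 * (5 * q + 4) \<and> 3 \<le> q \<or> n \<in> {16, 18, 28, 36}"
    unfolding q_def insert_iff empty_iff using assms by presburger
  consider "n = 2 * (5 * q)" "2 \<le> q" | "n = 2 * (5 * q + 1)" "2 \<le> q"
    | "n = 2 * (5 * q + 2)" "2 \<le> q" | "n = 2 * (5 * q + 3)" "4 \<le> q" | "n = 26"
    | "n = 2 * (5 * q + 4)" "3 \<le> q" | "n \<in> {16, 18, 28, 36}"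
    using cases by blast
  then show ?thesis
  proof cases
    case 1
    then have "n mod 10 = 0" by presburger
    with 1 have "\<not> ?R" by (auto; presburger)
    with not_gamma_critical_0[OF 1] show ?thesis by blast
  next
    case 2
    then have "n mod 10 = 2" by presburger
    with 2 have "?R" by (auto; presburger)
    with gamma_critical_1[OF 2] show ?thesis by blast
  next
    case 3
    then have "n mod 10 = 4" by presburger
    with 3 have "\<not> ?R" by (auto; presburger)
    with not_gamma_critical_2[OF 3] show ?thesis by blast
  next
    case 4
    then have "n mod 10 = 6" by presburger
    with 4 have "\<not> ?R" by (auto; presburger)
    with not_gamma_critical_3[OF 4] show ?thesis by blast
  next
    case 5
    then show ?thesis using gamma_critical_13 by simp
  next
    case 6
    then have "n mod 10 = 8" by presburger
    with 6 have "?R" by (auto; presburger)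
    with gamma_critical_4[OF 6] show ?thesis by blast
  next
    case 7
    then have "\<not> ?R" by auto
    with not_gamma_critical_small[OF 7] show ?thesis by blast
  qed
qed

end
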